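(* Suppose that the operators $\Pi^\ell$ ($\ell=0,1,2,3$) satisfy the commuting diagram and translation invariance assumption, that the shape function $S$ is admissible, and that $I^\ell_{\boldsymbol e_\alpha}:V_h^{\ell+1}\to V_h^\ell$ ($\ell=0,1,2$, $\alpha=1,2,3$) are discrete interior products (see context). Consider the scheme with unknowns $(\boldsymbol X_p(t),\boldsymbol V_p(t))_{p=1}^N\in(\mathbb R^3\times\mathbb R^3)^N$, $\boldsymbol E_h(t)\in V_h^2$, $\boldsymbol B_h(t)\in V_h^1$ obtained by coupling the discrete Maxwell equations $$ \begin{cases} -\partial_t\boldsymbol E_h+\operatorname{curl}\boldsymbol B_h=\sum_{p=1}^Nq_p\,\Pi^2(\boldsymbol V_pS_{\boldsymbol X_p}),\\ \partial_t\boldsymbol B_h+\operatorname{curl}_w\boldsymbol E_h=0 \end{cases} $$ with the modified particle equations $$ \frac{d\boldsymbol X_p}{dt}=\boldsymbol V_p,\qquad \frac{d\boldsymbol V_p}{dt}=\frac{q_p}{m_p}\big(\boldsymbol E^S(\boldsymbol X_p)+\boldsymbol R^S(\boldsymbol B_h,\boldsymbol X_p,\boldsymbol V_p)\big),\qquad p=1,\dots,N, $$ where the coupling fields are $$ \boldsymbol E^S(\boldsymbol X_p)=\sum_{\alpha=1}^3\boldsymbol e_\alpha\int_\Omega\boldsymbol E_h\cdot\big(I^2_{\boldsymbol e_\alpha}\Pi^3S_{\boldsymbol X_p}\big)\,d\boldsymbol x,\qquad \boldsymbol R^S(\boldsymbol B_h,\boldsymbol X_p,\boldsymbol V_p)=-\sum_{\alpha=1}^3\boldsymbol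 e_\alpha\int_\Omega\boldsymbol B_h\cdot\big(I^1_{\boldsymbol e_\alpha}\Pi^2(\boldsymbol V_pS_{\boldsymbol X_p})\big)\,d\boldsymbol x . $$ Then the scheme preserves the discrete Gauss laws $$\operatorname{div}\boldsymbol E_h=\Pi^3\Big(\sum_{p=1}^Nq_pS_{\boldsymbol X_p}\Big),\qquad \operatorname{div}_w\boldsymbol B_h=0$$ (each holds for all times if it holds initially), and for every solution satisfying these Gauss laws the discrete momentum $$\boldsymbol{\mathcal P}_h(t)=\sum_{p=1}^Nm_p\boldsymbol V_p(t)-\sum_{\alpha=1}^3\boldsymbol e_\alpha\int_\Omega\big(I^1_{\boldsymbol e_\alpha}\boldsymbol E_h(t,\boldsymbol x)\big)\cdot\boldsymbol B_h(t,\boldsymbol x)\,d\boldsymbol x$$ is constant in time.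
   Context: **Discrete spaces.** $\Omega$ is the spatial domain. $V_h^0,V_h^1,V_h^2,V_h^3$ are finite-dimensional spaces of square-integrable functions on $\Omega$ (scalar for $\ell=0,3$, $\mathbb R^3$-valued for $\ell=1,2$) with $\operatorname{grad}V_h^0\subset V_h^1$, $\operatorname{curl}V_h^1\subset V_h^2$, $\operatorname{div}V_h^2\subset V_h^3$. **Weak operators.** $\operatorname{curl}_w:V_h^2\to V_h^1$ and $\operatorname{div}_w:V_h^1\to V_h^0$ are the discrete adjoints defined by $\int_\Omega(\operatorname{curl}_w\boldsymbol F_h)\cdot\boldsymbol C_h=\int_\Omega\boldsymbol F_h\cdot\operatorname{curl}\boldsymbol C_h$ and $\int_\Omega(\operatorname{div}_w\boldsymbol C_h)\psi_h=-\int_\Omega\boldsymbol C_h\cdot\operatorname{grad}\psi_h$ for all $\boldsymbol F_h\in V_h^2$, $\boldsymbol C_h\in V_h^1$, $\psi_h\in V_h^0$. **Assumption on $\Pi^\ell$.** $V^0,V^1,V^2,V^3$ are infinite-dimensional linear function (or distribution) spaces (scalar for $\ell=0,3$, vector-valued for $\ell=1,2$) with $\operatorname{grad}V^0\subset V^1$, $\operatorname{curl}V^1\subset V^2$, $\operatorname{div}V^2\subset V^3$, each translation invariant ($G\in V^\ell\Rightarrow G(\cdot-\boldsymbol x)\in V^\ell$ for all $\boldsymbol x\in\mathbb R^3$). $\Pi^\ell:V^\ell\to V_h^\ell$ are linear projection operators such that $\Pi^1\operatorname{grad}G=\operatorname{grad}\Pi^0G$ for $G\in V^0$, $\Pi^2\operatorname{curl}\boldsymbol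 G=\operatorname{curl}\Pi^1\boldsymbol G$ for $\boldsymbol G\in V^1$, $\Pi^3\operatorname{div}\boldsymbol G=\operatorname{div}\Pi^2\boldsymbol G$ for $\boldsymbol G\in V^2$. **Admissible shape function.** A shape function $S$ is admissible if $S\in V^0$, $S\in V^3$, and $\boldsymbol eS\in V^1$, $\boldsymbol eS\in V^2$ for every $\boldsymbol e\in\mathbb R^3$. Write $S_{\boldsymbol y}(\boldsymbol x)=S(\boldsymbol x-\boldsymbol y)$. **Standing regularity.** It is understood that projected shape functions may be differentiated with respect to the particle position: $\boldsymbol y\mapsto\Pi^3S_{\boldsymbol y}\in V_h^3$ is $C^1$ with derivative in any direction $\boldsymbol e\in\mathbb R^3$ equal to $-\Pi^3(\boldsymbol e\cdot\operatorname{grad}S_{\boldsymbol y})=-\Pi^3\operatorname{div}(\boldsymbol eS_{\boldsymbol y})$. **Particles.** $N$ is the number of particles, $m_p\neq0$ and $q_p$ are real constants (particle masses and charges multiplied by their weights); $(\boldsymbol e_1,\boldsymbol e_2,\boldsymbol e_3)$ is the canonical basis of $\mathbb R^3$. **Discrete interior products.** These are linear operators $I^\ell_{\boldsymbol e_\alpha}=\mathcal A_{h,\alpha}\,\imath^\ell_{\boldsymbol e_\alpha}$ mapping $V_h^{\ell+1}$ to $V_h^\ell$, where $\imath^0_{\boldsymbol e_\alpha}\boldsymbol C=\boldsymbol C\cdot\boldsymbol e_\alpha$, $\imath^1_{\boldsymbol e_\alpha}\boldsymbol F=\boldsymbol F\times\boldsymbol e_\alpha$, $\imath^2_{\boldsymbol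 e_\alpha}g=g\,\boldsymbol e_\alpha$, and $\mathcal A_{h,\alpha}$ is a linear approximation operator (acting componentwise on vector fields), such that for every $\alpha\in\{1,2,3\}$ $$\int_\Omega\boldsymbol C_h\cdot\operatorname{grad}I^0_{\boldsymbol e_\alpha}\boldsymbol C_h=-\int_\Omega\boldsymbol C_h\cdot I^1_{\boldsymbol e_\alpha}\operatorname{curl}\boldsymbol C_h\quad\forall\boldsymbol C_h\in V_h^1,$$ $$\int_\Omega\boldsymbol F_h\cdot\operatorname{curl}I^1_{\boldsymbol e_\alpha}\boldsymbol F_h=-\int_\Omega\boldsymbol F_h\cdot I^2_{\boldsymbol e_\alpha}\operatorname{div}\boldsymbol F_h\quad\forall\boldsymbol F_h\in V_h^2.$$ *)

theory Defs
  imports "HOL-Analysis.Analysis"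
begin

section \<open>The Hilbert space of square-integrable functions\<close>

text \<open>
  Elements of \<open>L2\<close> are classes, modulo equality almost everywhere, of square-integrable
  real functions on the whole space.  A function on a domain \<open>\<Omega>\<close> is represented by its extension
  by zero (see \<open>L2_on\<close>), so that integrals over \<open>\<Omega>\<close> become values of the inner product of \<open>L2\<close>.
  Vector fields have type \<open>L2 ^ 3\<close>, whose library inner product is the sum over the components,
  i.e. the integral of the pointwise dot product.
\<close>

definition square_integrable :: "(real^3 \<Rightarrow> real) \<Rightarrow> bool" where
  "square_integrable f \<longleftrightarrow> f \<in> borel_measurable lborel \<and> integrable lborel (\<lambda>x. (f x)\<^sup>2)"

lemma square_integrable_mult:
  assumes "square_integrable f" "square_integrable g"
  shows "integrable lborel (\<lambda>x. f x * g x)"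
proof (rule Bochner_Integration.integrable_bound)
  show "integrable lborel (\<lambda>x. (f x)\<^sup>2 + (g x)\<^sup>2)"
    using assms by (auto simp: square_integrable_def)
  show "(\<lambda>x. f x * g x) \<in> borel_measurable lborel"
    using assms by (auto simp: square_integrable_def)
  have "\<bar>a * b\<bar> \<le> a\<^sup>2 + b\<^sup>2" for a b :: real
    using sum_squares_bound[of "\<bar>a\<bar>" "\<bar>b\<bar>"] mult_nonneg_nonneg[of "\<bar>a\<bar>" "\<bar>b\<bar>"]
    unfolding abs_mult power2_abs by linarith
  then show "AE x in lborel. norm (f x * g x) \<le> norm ((f x)\<^sup>2 + (g x)\<^sup>2)"
    by (auto intro!: AE_I2)
qed

lemma square_integrable_zero: "square_integrable (\<lambda>x. 0)"
  by (simp add: square_integrable_def)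

lemma square_integrable_add:
  assumes "square_integrable f" "square_integrable g"
  shows "square_integrable (\<lambda>x. f x + g x)"
  using assms square_integrable_mult[OF assms]
  by (auto simp: square_integrable_def power2_sum mult.assoc)

lemma square_integrable_scale: "square_integrable f \<Longrightarrow> square_integrable (\<lambda>x. c * f x)"
  by (auto simp: square_integrable_def power_mult_distrib)

lemma square_integrable_minus: "square_integrable f \<Longrightarrow> square_integrable (\<lambda>x. - f x)"
  by (auto simp: square_integrable_def)

lemma square_integrable_diff:
  assumes "square_integrable f" "square_integrable g"
  shows "square_integrable (\<lambda>x. f x - g x)"
  using square_integrable_add[OF assms(1) square_integrable_minus[OF assms(2)]] by simp

definition L2_rel :: "(real^3 \<Rightarrow> real) \<Rightarrow> (real^3 \<Rightarrow> real) \<Rightarrow> bool" where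
  "L2_rel f g \<longleftrightarrow> square_integrable f \<and> square_integrable g \<and> (AE x in lborel. f x = g x)"

lemma part_equivp_L2_rel: "part_equivp L2_rel"
proof (rule part_equivpI)
  show "\<exists>f. L2_rel f f"
    using square_integrable_zero by (auto simp: L2_rel_def)
  show "symp L2_rel"
    by (rule sympI) (auto simp: L2_rel_def elim!: AE_mp)
  show "transp L2_rel"
  proof (rule transpI)
    fix f g h assume fg: "L2_rel f g" and gh: "L2_rel g h"
    then have "AE x in lborel. f x = g x" "AE x in lborel. g x = h x"
      by (auto simp: L2_rel_def)
    then have "AE x in lborel. f x = h x"
      by eventually_elim simp
    with fg gh show "L2_rel f h" by (auto simp: L2_rel_def)
  qed
qed

quotient_type L2 = "real^3 \<Rightarrow> real" / partial: L2_rel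
  by (rule part_equivp_L2_rel)

instantiation L2 :: real_vector
begin

lift_definition zero_L2 :: L2 is "\<lambda>x. 0"
  by (simp add: L2_rel_def square_integrable_zero)

lift_definition plus_L2 :: "L2 \<Rightarrow> L2 \<Rightarrow> L2" is "\<lambda>f g x. f x + g x"
  by (auto simp: L2_rel_def square_integrable_add elim!: AE_mp)

lift_definition minus_L2 :: "L2 \<Rightarrow> L2 \<Rightarrow> L2" is "\<lambda>f g x. f x - g x"
  by (auto simp: L2_rel_def square_integrable_diff elim!: AE_mp)

lift_definition uminus_L2 :: "L2 \<Rightarrow> L2" is "\<lambda>f x. - f x"
  by (auto simp: L2_rel_def square_integrable_minus elim!: AE_mp)

lift_definition scaleR_L2 :: "real \<Rightarrow> L2 \<Rightarrow> L2" is "\<lambda>c f x. c * f x"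
  by (auto simp: L2_rel_def square_integrable_scale elim!: AE_mp)

instance
  by standard
    (transfer; auto simp: L2_rel_def algebra_simps
      intro!: square_integrable_zero square_integrable_add square_integrable_minus
        square_integrable_diff square_integrable_scale)+

end

instantiation L2 :: real_inner
begin

lift_definition inner_L2 :: "L2 \<Rightarrow> L2 \<Rightarrow> real" is "\<lambda>f g. LINT x|lborel. f x * g x"
  by (rule Bochner_Integration.integral_cong_AE)
     (auto simp: L2_rel_def square_integrable_def elim!: AE_mp)

definition norm_L2 :: "L2 \<Rightarrow> real" where "norm_L2 u = sqrt (u \<bullet> u)"
definition dist_L2 :: "L2 \<Rightarrow> L2 \<Rightarrow> real" where "dist_L2 u v = norm (u - v)"
definition sgn_L2 :: "L2 \<Rightarrow> L2" where "sgn_L2 u = u /\<^sub>R norm u"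
definition uniformity_L2 :: "(L2 \<times> L2) filter" where
  "uniformity_L2 = (INF e\<in>{0<..}. principal {(x, y). dist x y < e})"
definition open_L2 :: "L2 set \<Rightarrow> bool" where
  "open_L2 U \<longleftrightarrow> (\<forall>x\<in>U. eventually (\<lambda>(x', y). x' = x \<longrightarrow> y \<in> U) uniformity)"

instance
proof
  fix u v w :: L2 and r :: real and U :: "L2 set"
  show "dist u v = norm (u - v)" by (fact dist_L2_def)
  show "sgn u = u /\<^sub>R norm u" by (fact sgn_L2_def)
  show "uniformity = (INF e\<in>{0<..}. principal {(x :: L2, y). dist x y < e})"
    by (fact uniformity_L2_def)
  show "open U \<longleftrightarrow> (\<forall>x\<in>U. eventually (\<lambda>(x', y). x' = x \<longrightarrow> y \<in> U) uniformity)"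
    by (fact open_L2_def)
  show "norm u = sqrt (u \<bullet> u)" by (fact norm_L2_def)
  show "u \<bullet> v = v \<bullet> u" by transfer (simp add: mult.commute)
  show "(u + v) \<bullet> w = u \<bullet> w + v \<bullet> w"
    by transfer (auto simp: L2_rel_def distrib_right square_integrable_mult
        intro!: Bochner_Integration.integral_add)
  show "(r *\<^sub>R u) \<bullet> v = r * (u \<bullet> v)"
    by transfer (simp add: mult.assoc)
  show "0 \<le> u \<bullet> u" by transfer (simp add: integral_nonneg_AE)
  show "u \<bullet> u = 0 \<longleftrightarrow> u = 0"
  proof transfer
    fix f assume "L2_rel f f"
    then have f: "square_integrable f" by (simp add: L2_rel_def)
    have "(LINT x|lborel. f x * f x) = 0 \<longleftrightarrow> (AE x in lborel. f x * f x = 0)"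
      by (rule integral_nonneg_eq_0_iff_AE) (use square_integrable_mult[OF f f] in auto)
    then show "(LINT x|lborel. f x * f x) = 0 \<longleftrightarrow> L2_rel f (\<lambda>x. 0)"
      using f by (simp add: L2_rel_def square_integrable_zero)
  qed
qed

end

lift_definition vanishes_outside :: "(real^3) set \<Rightarrow> L2 \<Rightarrow> bool" is
  "\<lambda>\<Omega> f. AE x in lborel. x \<notin> \<Omega> \<longrightarrow> f x = 0"
  by (auto simp: L2_rel_def elim!: AE_mp)

definition L2_on :: "(real^3) set \<Rightarrow> L2 set" where
  "L2_on \<Omega> = {u. vanishes_outside \<Omega> u}"


section \<open>Distributions\<close>

definition partial :: "3 \<Rightarrow> (real^3 \<Rightarrow> real) \<Rightarrow> real^3 \<Rightarrow> real" where
  "partial i f x = frechet_derivative f (at x) (axis i 1)"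

definition partials :: "3 list \<Rightarrow> (real^3 \<Rightarrow> real) \<Rightarrow> real^3 \<Rightarrow> real" where
  "partials js f = foldr partial js f"

definition smooth :: "(real^3 \<Rightarrow> real) \<Rightarrow> bool" where
  "smooth f \<longleftrightarrow> (\<forall>js x. partials js f differentiable (at x))"

definition supp :: "(real^3 \<Rightarrow> real) \<Rightarrow> (real^3) set" where
  "supp f = closure {x. f x \<noteq> 0}"

definition test_functions :: "(real^3) set \<Rightarrow> (real^3 \<Rightarrow> real) set" where
  "test_functions \<Omega> = {\<phi>. smooth \<phi> \<and> compact (supp \<phi>) \<and> supp \<phi> \<subseteq> \<Omega>}"

lemma partial_lincomb:
  assumes "\<And>x. f differentiable (at x)" "\<And>x. g differentiable (at x)"
  shows "partial i (\<lambda>x. a * f x + b * g x) = (\<lambda>x. a * partial i f x + b * partial i g x)"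
proof
  fix x
  have "((\<lambda>x. a * f x + b * g x) has_derivative
      (\<lambda>h. a * frechet_derivative f (at x) h + b * frechet_derivative g (at x) h)) (at x)"
    using assms unfolding frechet_derivative_works by (auto intro!: derivative_eq_intros)
  from frechet_derivative_at[OF this]
  show "partial i (\<lambda>x. a * f x + b * g x) x = a * partial i f x + b * partial i g x"
    unfolding partial_def by metis
qed

lemma partials_lincomb:
  assumes "smooth f" "smooth g"
  shows "partials js (\<lambda>x. a * f x + b * g x) = (\<lambda>x. a * partials js f x + b * partials js g x)"
proof (induction js)
  case (Cons j js)
  have "partials (j # js) (\<lambda>x. a * f x + b * g x) = partial j (partials js (\<lambda>x. a * f x + b * g x))"
    by (simp add: partials_def)
  also have "\<dots> = (\<lambda>x. a * partial j (partials js f) x + b * partial j (partials js g) x)"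
    unfolding Cons.IH by (rule partial_lincomb) (use assms in \<open>auto simp: smooth_def\<close>)
  finally show ?case by (simp add: partials_def)
qed (simp add: partials_def)

lemma smooth_lincomb:
  assumes "smooth f" "smooth g"
  shows "smooth (\<lambda>x. a * f x + b * g x)"
  using assms unfolding smooth_def partials_lincomb[OF assms]
  by (auto intro!: differentiable_add differentiable_mult)

lemma test_functions_lincomb:
  assumes "f \<in> test_functions \<Omega>" "g \<in> test_functions \<Omega>"
  shows "(\<lambda>x. a * f x + b * g x) \<in> test_functions \<Omega>"
proof -
  have "supp (\<lambda>x. a * f x + b * g x) \<subseteq> supp f \<union> supp g"
    unfolding supp_def closure_Un[symmetric] by (rule closure_mono) auto
  moreover have "closed (supp (\<lambda>x. a * f x + b * g x))"
    by (simp add: supp_def)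
  moreover have "compact (supp f \<union> supp g)" "supp f \<union> supp g \<subseteq> \<Omega>"
    using assms by (auto simp: test_functions_def)
  ultimately have "compact (supp (\<lambda>x. a * f x + b * g x))" and "supp (\<lambda>x. a * f x + b * g x) \<subseteq> \<Omega>"
    using compact_Int_closed[of "supp f \<union> supp g" "supp (\<lambda>x. a * f x + b * g x)"]
    by (simp add: Int_absorb1, blast)
  then show ?thesis
    using assms smooth_lincomb[of f g a b] by (simp add: test_functions_def)
qed

lemma partials_partial: "partials js (partial i f) = partials (js @ [i]) f"
  by (simp add: partials_def)

lemma test_functions_partial:
  assumes "f \<in> test_functions \<Omega>"
  shows "partial i f \<in> test_functions \<Omega>" and "supp (partial i f) \<subseteq> supp f"
proof -
  show *: "supp (partial i f) \<subseteq> supp f"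
    unfolding supp_def
  proof (rule closure_minimal)
    show "{x. partial i f x \<noteq> 0} \<subseteq> closure {x. f x \<noteq> 0}"
    proof
      fix x assume "x \<in> {x. partial i f x \<noteq> 0}"
      moreover have "partial i f x = 0" if "x \<in> - closure {x. f x \<noteq> 0}"
      proof -
        have "frechet_derivative f (at x) = frechet_derivative (\<lambda>x. 0) (at x)"
        proof (rule sym, rule frechet_derivative_transform_within_open)
          show "(\<lambda>x. 0 :: real) differentiable at x" by simp
          show "open (- closure {x. f x \<noteq> 0})" by auto
          show "x \<in> - closure {x. f x \<noteq> 0}" by fact
          show "0 = f y" if "y \<in> - closure {x. f x \<noteq> 0}" for y
            using that closure_subset[of "{x. f x \<noteq> 0}"] by auto
        qed
        then show ?thesis by (simp add: partial_def)
      qed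
      ultimately show "x \<in> closure {x. f x \<noteq> 0}" by auto
    qed
  qed simp
  moreover have "closed (supp (partial i f))"
    by (simp add: supp_def)
  moreover have "smooth (partial i f)"
    using assms by (simp add: test_functions_def smooth_def partials_partial)
  ultimately show "partial i f \<in> test_functions \<Omega>"
    using assms compact_Int_closed[of "supp f" "supp (partial i f)"]
    by (auto simp: test_functions_def Int_absorb1)
qed

definition translate :: "real^3 \<Rightarrow> (real^3 \<Rightarrow> real) \<Rightarrow> real^3 \<Rightarrow> real" where
  "translate y f x = f (x + y)"

lemma has_derivative_translate:
  assumes "(f has_derivative f') (at (x + y))"
  shows "(translate y f has_derivative f') (at x)"
proof -
  have "((\<lambda>x. x + y) has_derivative (\<lambda>h. h)) (at x)"
    by (auto intro!: derivative_eq_intros)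
  from has_derivative_compose[OF this assms] show ?thesis
    by (simp add: translate_def[abs_def])
qed

lemma has_derivative_translate_iff:
  "(translate y f has_derivative f') (at x) \<longleftrightarrow> (f has_derivative f') (at (x + y))"
  using has_derivative_translate[of f f' x y] has_derivative_translate[of "translate y f" f' "x + y" "- y"]
  by (auto simp: translate_def[abs_def])

lemma partials_translate: "partials js (translate y f) = translate y (partials js f)"
proof (induction js)
  case (Cons j js)
  have "partial j (translate y g) = translate y (partial j g)" for g
    unfolding partial_def[abs_def] frechet_derivative_def has_derivative_translate_iff
    by (simp add: translate_def[abs_def])
  then show ?case using Cons.IH by (simp add: partials_def)
qed (simp add: partials_def)

lemma smooth_translate: "smooth f \<Longrightarrow> smooth (translate y f)"
  by (auto simp: smooth_def partials_translate differentiable_def has_derivative_translate_iff)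

lemma supp_translate: "supp (translate y f) = (\<lambda>x. x - y) ` supp f"
proof -
  have "x \<in> (\<lambda>x. x - y) ` {x. f x \<noteq> 0}" if "f (x + y) \<noteq> 0" for x
    by (rule image_eqI[of _ _ "x + y"]) (use that in simp_all)
  then have "{x. translate y f x \<noteq> 0} = (\<lambda>x. x - y) ` {x. f x \<noteq> 0}"
    by (auto simp: translate_def)
  then show ?thesis
    unfolding supp_def by (simp only: closure_translation_subtract)
qed

lemma test_functions_translate_iff:
  "translate y f \<in> test_functions UNIV \<longleftrightarrow> f \<in> test_functions UNIV"
proof -
  have *: "translate y f \<in> test_functions UNIV" if "f \<in> test_functions UNIV" for y f
    using that by (auto simp: test_functions_def smooth_translate supp_translate
        intro: compact_translation_subtract)
  show ?thesis
    using *[of f y] *[of "translate y f" "- y"] by (auto simp: translate_def[abs_def])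
qed


text \<open>
  Continuity on the test functions is the usual seminorm estimate on each compact set.  Outside
  the test functions a distribution is set to \<open>0\<close>, so that equality of distributions is equality
  of functionals on test functions.
\<close>

definition is_distribution :: "((real^3 \<Rightarrow> real) \<Rightarrow> real) \<Rightarrow> bool" where
  "is_distribution T \<longleftrightarrow>
     (\<forall>\<phi>\<in>test_functions UNIV. \<forall>\<psi>\<in>test_functions UNIV. \<forall>a b.
        T (\<lambda>x. a * \<phi> x + b * \<psi> x) = a * T \<phi> + b * T \<psi>) \<and>
     (\<forall>K. compact K \<longrightarrow> (\<exists>C k. \<forall>\<phi>\<in>test_functions UNIV. \<forall>M. supp \<phi> \<subseteq> K \<longrightarrow>
        (\<forall>js x. length js \<le> k \<longrightarrow> \<bar>partials js \<phi> x\<bar> \<le> M) \<longrightarrow> \<bar>T \<phi>\<bar> \<le> C * M)) \<and>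
     (\<forall>\<phi>. \<phi> \<notin> test_functions UNIV \<longrightarrow> T \<phi> = 0)"

lemma is_distribution_lincomb:
  assumes T: "is_distribution T" and U: "is_distribution U"
  shows "is_distribution (\<lambda>\<phi>. a * T \<phi> + b * U \<phi>)"
proof -
  have "\<exists>C k. \<forall>\<phi>\<in>test_functions UNIV. \<forall>M. supp \<phi> \<subseteq> K \<longrightarrow>
      (\<forall>js x. length js \<le> k \<longrightarrow> \<bar>partials js \<phi> x\<bar> \<le> M) \<longrightarrow> \<bar>a * T \<phi> + b * U \<phi>\<bar> \<le> C * M"
    if K: "compact K" for K
  proof -
    from T K obtain C k where C: "\<And>\<phi> M. \<phi> \<in> test_functions UNIV \<Longrightarrow> supp \<phi> \<subseteq> K \<Longrightarrow>
        (\<And>js x. length js \<le> k \<Longrightarrow> \<bar>partials js \<phi> x\<bar> \<le> M) \<Longrightarrow> \<bar>T \<phi>\<bar> \<le> C * M"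
      unfolding is_distribution_def by meson
    from U K obtain D l where D: "\<And>\<phi> M. \<phi> \<in> test_functions UNIV \<Longrightarrow> supp \<phi> \<subseteq> K \<Longrightarrow>
        (\<And>js x. length js \<le> l \<Longrightarrow> \<bar>partials js \<phi> x\<bar> \<le> M) \<Longrightarrow> \<bar>U \<phi>\<bar> \<le> D * M"
      unfolding is_distribution_def by meson
    have "\<bar>a * T \<phi> + b * U \<phi>\<bar> \<le> (\<bar>a\<bar> * C + \<bar>b\<bar> * D) * M"
      if "\<phi> \<in> test_functions UNIV" "supp \<phi> \<subseteq> K"
        and M: "\<And>js x. length js \<le> max k l \<Longrightarrow> \<bar>partials js \<phi> x\<bar> \<le> M" for \<phi> M
    proof -
      have "\<bar>T \<phi>\<bar> \<le> C * M" "\<bar>U \<phi>\<bar> \<le> D * M"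
        by (rule C D; use that in simp)+
      then have "\<bar>a\<bar> * \<bar>T \<phi>\<bar> + \<bar>b\<bar> * \<bar>U \<phi>\<bar> \<le> \<bar>a\<bar> * (C * M) + \<bar>b\<bar> * (D * M)"
        by (intro add_mono mult_left_mono) auto
      then show ?thesis
        using abs_triangle_ineq[of "a * T \<phi>" "b * U \<phi>"] by (simp add: abs_mult algebra_simps)
    qed
    then show ?thesis by blast
  qed
  moreover have "a * T (\<lambda>x. c * \<phi> x + d * \<psi> x) + b * U (\<lambda>x. c * \<phi> x + d * \<psi> x) =
      c * (a * T \<phi> + b * U \<phi>) + d * (a * T \<psi> + b * U \<psi>)"
    if "\<phi> \<in> test_functions UNIV" "\<psi> \<in> test_functions UNIV" for \<phi> \<psi> c d
    using T U that by (simp add: is_distribution_def algebra_simps)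
  ultimately show ?thesis
    using T U by (simp add: is_distribution_def)
qed

lemma is_distribution_zero: "is_distribution (\<lambda>\<phi>. 0)"
  unfolding is_distribution_def by (auto intro!: exI[of _ 0])

typedef distribution = "{T. is_distribution T}"
  morphisms eval_distribution Abs_distribution
  using is_distribution_zero by blast

setup_lifting type_definition_distribution

instantiation distribution :: real_vector
begin

lift_definition zero_distribution :: distribution is "\<lambda>\<phi>. 0"
  by (rule is_distribution_zero)

lift_definition plus_distribution :: "distribution \<Rightarrow> distribution \<Rightarrow> distribution" is
  "\<lambda>T U \<phi>. T \<phi> + U \<phi>"
  subgoal for T U using is_distribution_lincomb[of T U 1 1] by simp
  done

lift_definition minus_distribution :: "distribution \<Rightarrow> distribution \<Rightarrow> distribution" is
  "\<lambda>T U \<phi>. T \<phi> - U \<phi>"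
  subgoal for T U using is_distribution_lincomb[of T U 1 "- 1"] by simp
  done

lift_definition uminus_distribution :: "distribution \<Rightarrow> distribution" is "\<lambda>T \<phi>. - T \<phi>"
  subgoal for T using is_distribution_lincomb[of T T "- 1" 0] by simp
  done

lift_definition scaleR_distribution :: "real \<Rightarrow> distribution \<Rightarrow> distribution" is "\<lambda>c T \<phi>. c * T \<phi>"
  subgoal for c T using is_distribution_lincomb[of T T c 0] by simp
  done

instance
  by standard (transfer; auto simp: fun_eq_iff algebra_simps)+

end

lift_definition dpartial :: "3 \<Rightarrow> distribution \<Rightarrow> distribution" is
  "\<lambda>i T \<phi>. if \<phi> \<in> test_functions UNIV then - T (partial i \<phi>) else 0"
proof -
  fix i and T :: "(real^3 \<Rightarrow> real) \<Rightarrow> real"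
  assume T: "is_distribution T"
  let ?T = "\<lambda>\<phi>. if \<phi> \<in> test_functions UNIV then - T (partial i \<phi>) else 0"
  have "\<exists>C k. \<forall>\<phi>\<in>test_functions UNIV. \<forall>M. supp \<phi> \<subseteq> K \<longrightarrow>
      (\<forall>js x. length js \<le> k \<longrightarrow> \<bar>partials js \<phi> x\<bar> \<le> M) \<longrightarrow> \<bar>?T \<phi>\<bar> \<le> C * M"
    if K: "compact K" for K
  proof -
    from T K obtain C k where C: "\<And>\<phi> M. \<phi> \<in> test_functions UNIV \<Longrightarrow> supp \<phi> \<subseteq> K \<Longrightarrow>
        (\<And>js x. length js \<le> k \<Longrightarrow> \<bar>partials js \<phi> x\<bar> \<le> M) \<Longrightarrow> \<bar>T \<phi>\<bar> \<le> C * M"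
      unfolding is_distribution_def by meson
    have "\<bar>?T \<phi>\<bar> \<le> C * M"
      if "\<phi> \<in> test_functions UNIV" "supp \<phi> \<subseteq> K"
        and M: "\<And>js x. length js \<le> Suc k \<Longrightarrow> \<bar>partials js \<phi> x\<bar> \<le> M" for \<phi> M
      using that test_functions_partial[OF that(1), of i] C[of "partial i \<phi>" M]
      by (simp add: partials_partial)
    then show ?thesis by blast
  qed
  moreover have "?T (\<lambda>x. a * \<phi> x + b * \<psi> x) = a * ?T \<phi> + b * ?T \<psi>"
    if \<phi>: "\<phi> \<in> test_functions UNIV" and \<psi>: "\<psi> \<in> test_functions UNIV" for \<phi> \<psi> a b
  proof -
    have "\<And>x. \<phi> differentiable (at x)" "\<And>x. \<psi> differentiable (at x)"
      using \<phi> \<psi> by (auto simp: test_functions_def smooth_def partials_def dest: spec[of _ "[]"])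
    then show ?thesis
      using T \<phi> \<psi> test_functions_lincomb[OF \<phi> \<psi>, of a b] test_functions_partial(1)[of _ UNIV i]
      by (simp add: partial_lincomb is_distribution_def)
  qed
  ultimately show "is_distribution ?T"
    unfolding is_distribution_def by simp
qed

text \<open>\<open>shift y T\<close> is the distribution \<open>T(\<cdot> - y)\<close>.\<close>

lift_definition shift :: "real^3 \<Rightarrow> distribution \<Rightarrow> distribution" is
  "\<lambda>y T \<phi>. T (translate y \<phi>)"
proof -
  fix y and T :: "(real^3 \<Rightarrow> real) \<Rightarrow> real"
  assume T: "is_distribution T"
  have "\<exists>C k. \<forall>\<phi>\<in>test_functions UNIV. \<forall>M. supp \<phi> \<subseteq> K \<longrightarrow>
      (\<forall>js x. length js \<le> k \<longrightarrow> \<bar>partials js \<phi> x\<bar> \<le> M) \<longrightarrow> \<bar>T (translate y \<phi>)\<bar> \<le> C * M"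
    if K: "compact K" for K
  proof -
    have "compact ((\<lambda>x. x - y) ` K)"
      using K by (rule compact_translation_subtract)
    with T obtain C k where C: "\<And>\<phi> M. \<phi> \<in> test_functions UNIV \<Longrightarrow> supp \<phi> \<subseteq> (\<lambda>x. x - y) ` K \<Longrightarrow>
        (\<And>js x. length js \<le> k \<Longrightarrow> \<bar>partials js \<phi> x\<bar> \<le> M) \<Longrightarrow> \<bar>T \<phi>\<bar> \<le> C * M"
      unfolding is_distribution_def by meson
    have "\<bar>T (translate y \<phi>)\<bar> \<le> C * M"
      if "\<phi> \<in> test_functions UNIV" "supp \<phi> \<subseteq> K"
        and M: "\<And>js x. length js \<le> k \<Longrightarrow> \<bar>partials js \<phi> x\<bar> \<le> M" for \<phi> M
    proof (rule C)
      show "translate y \<phi> \<in> test_functions UNIV"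
        using that(1) by (simp add: test_functions_translate_iff)
      show "supp (translate y \<phi>) \<subseteq> (\<lambda>x. x - y) ` K"
        unfolding supp_translate using that(2) by (rule image_mono)
      show "\<bar>partials js (translate y \<phi>) x\<bar> \<le> M" if "length js \<le> k" for js x
        using M[OF that] by (simp add: partials_translate translate_def)
    qed
    then show ?thesis by blast
  qed
  moreover have "T (translate y (\<lambda>x. a * \<phi> x + b * \<psi> x)) = a * T (translate y \<phi>) + b * T (translate y \<psi>)"
    if "\<phi> \<in> test_functions UNIV" "\<psi> \<in> test_functions UNIV" for \<phi> \<psi> a b
  proof -
    have "translate y (\<lambda>x. a * \<phi> x + b * \<psi> x) = (\<lambda>x. a * translate y \<phi> x + b * translate y \<psi> x)"
      by (simp add: translate_def[abs_def])
    then show ?thesis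
      using T that by (simp add: is_distribution_def test_functions_translate_iff)
  qed
  ultimately show "is_distribution (\<lambda>\<phi>. T (translate y \<phi>))"
    using T unfolding is_distribution_def by (simp add: test_functions_translate_iff)
qed

lemma test_functions_bounded_measurable:
  assumes "\<phi> \<in> test_functions UNIV"
  shows "\<phi> \<in> borel_measurable lborel" "\<exists>M. \<forall>x. \<bar>\<phi> x\<bar> \<le> M * indicator (supp \<phi>) x"
proof -
  have "\<phi> differentiable (at x)" for x
    using assms by (auto simp: test_functions_def smooth_def partials_def dest: spec[of _ "[]"])
  then have cont: "continuous_on A \<phi>" for A
    by (meson continuous_at_imp_continuous_on differentiable_imp_continuous_within)
  then show "\<phi> \<in> borel_measurable lborel"
    by (simp add: borel_measurable_continuous_onI)
  have "compact (\<phi> ` supp \<phi>)"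
    using assms cont by (auto simp: test_functions_def intro: compact_continuous_image)
  then obtain M where M: "\<And>x. x \<in> supp \<phi> \<Longrightarrow> \<bar>\<phi> x\<bar> \<le> M"
    using compact_imp_bounded[of "\<phi> ` supp \<phi>"] unfolding bounded_iff by fastforce
  have "\<phi> x = 0" if "x \<notin> supp \<phi>" for x
    using that closure_subset[of "{x. \<phi> x \<noteq> 0}"] by (auto simp: supp_def)
  with M show "\<exists>M. \<forall>x. \<bar>\<phi> x\<bar> \<le> M * indicator (supp \<phi>) x"
    by (intro exI[of _ M]) (auto simp: indicator_def)
qed

lemma square_integrable_imp_integrable_on_compact:
  assumes f: "square_integrable f" and K: "compact K"
  shows "integrable lborel (\<lambda>x. \<bar>f x\<bar> * indicator K x)"
proof -
  have "square_integrable (\<lambda>x. indicator K x :: real)"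
    using borel_compact[OF K] emeasure_compact_finite[OF K]
    by (auto simp: square_integrable_def power2_eq_square indicator_inter_arith[symmetric]
        intro!: integrable_real_indicator)
  moreover have "square_integrable (\<lambda>x. \<bar>f x\<bar>)"
    using f by (auto simp: square_integrable_def)
  ultimately show ?thesis
    using square_integrable_mult by blast
qed

lemma L2_functional:
  assumes "L2_rel f g"
  defines "T \<equiv> \<lambda>f \<phi>. if \<phi> \<in> test_functions UNIV then LINT x|lborel. f x * \<phi> x else 0 :: real"
  shows "is_distribution (T f)" "T f = T g"
proof -
  from assms have f: "square_integrable f" by (simp add: L2_rel_def)
  have int: "integrable lborel (\<lambda>x. f x * \<phi> x)" if \<phi>: "\<phi> \<in> test_functions UNIV" for \<phi>
  proof -
    obtain M where M: "\<And>x. \<bar>\<phi> x\<bar> \<le> M * indicator (supp \<phi>) x"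
      using test_functions_bounded_measurable(2)[OF \<phi>] by blast
    show ?thesis
    proof (rule Bochner_Integration.integrable_bound)
      show "integrable lborel (\<lambda>x. M * (\<bar>f x\<bar> * indicator (supp \<phi>) x))"
        using \<phi> f by (intro integrable_mult_right square_integrable_imp_integrable_on_compact)
          (auto simp: test_functions_def)
      show "(\<lambda>x. f x * \<phi> x) \<in> borel_measurable lborel"
        using f test_functions_bounded_measurable(1)[OF \<phi>] by (auto simp: square_integrable_def)
      have "\<bar>f x\<bar> * \<bar>\<phi> x\<bar> \<le> \<bar>f x\<bar> * (M * indicator (supp \<phi>) x)" for x
        by (intro mult_left_mono M) simp
      then have "\<bar>f x * \<phi> x\<bar> \<le> \<bar>M * (\<bar>f x\<bar> * indicator (supp \<phi>) x)\<bar>" for x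
        unfolding abs_mult[of "f x"] mult.left_commute[of M] by (rule order_trans[OF _ abs_ge_self])
      then show "AE x in lborel. norm (f x * \<phi> x) \<le> norm (M * (\<bar>f x\<bar> * indicator (supp \<phi>) x))"
        by (auto intro: AE_I2)
    qed
  qed
  have "\<exists>C k. \<forall>\<phi>\<in>test_functions UNIV. \<forall>M. supp \<phi> \<subseteq> K \<longrightarrow>
      (\<forall>js x. length js \<le> k \<longrightarrow> \<bar>partials js \<phi> x\<bar> \<le> M) \<longrightarrow> \<bar>T f \<phi>\<bar> \<le> C * M"
    if K: "compact K" for K
  proof -
    have "\<bar>T f \<phi>\<bar> \<le> (LINT x|lborel. \<bar>f x\<bar> * indicator K x) * M"
      if \<phi>: "\<phi> \<in> test_functions UNIV" and "supp \<phi> \<subseteq> K" and "\<forall>x. \<bar>partials [] \<phi> x\<bar> \<le> M" for \<phi> M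
    proof -
      have "\<bar>f x * \<phi> x\<bar> \<le> \<bar>f x\<bar> * indicator K x * M" for x
      proof (cases "x \<in> K")
        case True
        then show ?thesis
          using that(3) by (auto simp: partials_def abs_mult intro!: mult_left_mono)
      next
        case False
        with \<open>supp \<phi> \<subseteq> K\<close> have "\<phi> x = 0"
          using closure_subset[of "{x. \<phi> x \<noteq> 0}"] by (auto simp: supp_def)
        then show ?thesis using False by simp
      qed
      then have "(LINT x|lborel. \<bar>f x * \<phi> x\<bar>) \<le> (LINT x|lborel. \<bar>f x\<bar> * indicator K x * M)"
        using int[OF \<phi>] square_integrable_imp_integrable_on_compact[OF f K]
        by (intro integral_mono) auto
      from order_trans[OF integral_abs_bound this] show ?thesis
        using \<phi> by (simp add: T_def)
    qed
    then show ?thesis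
      by (intro exI[of _ "LINT x|lborel. \<bar>f x\<bar> * indicator K x"] exI[of _ 0]) simp
  qed
  moreover have "T f (\<lambda>x. a * \<phi> x + b * \<psi> x) = a * T f \<phi> + b * T f \<psi>"
    if "\<phi> \<in> test_functions UNIV" "\<psi> \<in> test_functions UNIV" for \<phi> \<psi> a b
  proof -
    have "(\<lambda>x. f x * (a * \<phi> x + b * \<psi> x)) = (\<lambda>x. a * (f x * \<phi> x) + b * (f x * \<psi> x))"
      by (simp add: algebra_simps)
    then show ?thesis
      using that int test_functions_lincomb[OF that] by (simp add: T_def)
  qed
  ultimately show "is_distribution (T f)"
    unfolding is_distribution_def by (simp add: T_def)
  show "T f = T g"
  proof
    fix \<phi>
    have "(LINT x|lborel. f x * \<phi> x) = (LINT x|lborel. g x * \<phi> x)" if "\<phi> \<in> test_functions UNIV"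
    proof (rule Bochner_Integration.integral_cong_AE)
      show "(\<lambda>x. f x * \<phi> x) \<in> borel_measurable lborel" "(\<lambda>x. g x * \<phi> x) \<in> borel_measurable lborel"
        using assms(1) test_functions_bounded_measurable(1)[OF that]
        by (auto simp: L2_rel_def square_integrable_def)
      have "AE x in lborel. f x = g x"
        using assms(1) by (simp add: L2_rel_def)
      then show "AE x in lborel. f x * \<phi> x = g x * \<phi> x"
        by eventually_elim simp
    qed
    then show "T f \<phi> = T g \<phi>"
      by (simp add: T_def)
  qed
qed

lift_definition of_L2 :: "L2 \<Rightarrow> distribution" is
  "\<lambda>f \<phi>. if \<phi> \<in> test_functions UNIV then LINT x|lborel. f x * \<phi> x else 0"
  using L2_functional by (simp add: eq_onp_def)


section \<open>Differential operators\<close>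

definition vscale :: "real^3 \<Rightarrow> 'a::real_vector \<Rightarrow> 'a^3" where
  "vscale e u = (\<chi> i. (e $ i) *\<^sub>R u)"

definition shift_vec :: "real^3 \<Rightarrow> distribution^3 \<Rightarrow> distribution^3" where
  "shift_vec y G = (\<chi> i. shift y (G $ i))"

definition of_L2_vec :: "L2^3 \<Rightarrow> distribution^3" where
  "of_L2_vec F = (\<chi> i. of_L2 (F $ i))"

definition dgrad :: "distribution \<Rightarrow> distribution^3" where
  "dgrad G = (\<chi> i. dpartial i G)"

definition dcurl :: "distribution^3 \<Rightarrow> distribution^3" where
  "dcurl G = vector
     [dpartial 2 (G $ 3) - dpartial 3 (G $ 2),
      dpartial 3 (G $ 1) - dpartial 1 (G $ 3),
      dpartial 1 (G $ 2) - dpartial 2 (G $ 1)]"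

definition ddiv :: "distribution^3 \<Rightarrow> distribution" where
  "ddiv G = (\<Sum>i\<in>UNIV. dpartial i (G $ i))"

definition eq_on :: "(real^3) set \<Rightarrow> distribution \<Rightarrow> distribution \<Rightarrow> bool" where
  "eq_on \<Omega> T U \<longleftrightarrow> (\<forall>\<phi>\<in>test_functions \<Omega>. eval_distribution T \<phi> = eval_distribution U \<phi>)"

definition eq_vec_on :: "(real^3) set \<Rightarrow> distribution^3 \<Rightarrow> distribution^3 \<Rightarrow> bool" where
  "eq_vec_on \<Omega> F G \<longleftrightarrow> (\<forall>i. eq_on \<Omega> (F $ i) (G $ i))"

text \<open>
  For square-integrable fields, \<open>has_grad\<close>, \<open>has_curl\<close> and \<open>has_div\<close> say that the first field has
  the second one as its weak gradient, curl or divergence on \<open>\<Omega>\<close>.  Only test functions supported in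
  \<open>\<Omega>\<close> are used, so the extension by zero creates no boundary terms.  On fields vanishing outside
  an open set \<open>\<Omega>\<close> the second field is uniquely determined by the first one.
\<close>

definition has_grad :: "(real^3) set \<Rightarrow> L2 \<Rightarrow> L2^3 \<Rightarrow> bool" where
  "has_grad \<Omega> u G \<longleftrightarrow> eq_vec_on \<Omega> (dgrad (of_L2 u)) (of_L2_vec G)"

definition has_curl :: "(real^3) set \<Rightarrow> L2^3 \<Rightarrow> L2^3 \<Rightarrow> bool" where
  "has_curl \<Omega> C K \<longleftrightarrow> eq_vec_on \<Omega> (dcurl (of_L2_vec C)) (of_L2_vec K)"

definition has_div :: "(real^3) set \<Rightarrow> L2^3 \<Rightarrow> L2 \<Rightarrow> bool" where
  "has_div \<Omega> F g \<longleftrightarrow> eq_on \<Omega> (ddiv (of_L2_vec F)) (of_L2 g)"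


section \<open>Discrete spaces, weak operators and projections\<close>

definition L2_vec_on :: "(real^3) set \<Rightarrow> (L2^3) set" where
  "L2_vec_on \<Omega> = {F. \<forall>i. F $ i \<in> L2_on \<Omega>}"

definition linear_map_on ::
  "'a::real_vector set \<Rightarrow> 'b::real_vector set \<Rightarrow> ('a \<Rightarrow> 'b) \<Rightarrow> bool" where
  "linear_map_on V W f \<longleftrightarrow> (\<forall>u\<in>V. f u \<in> W) \<and>
     (\<forall>u\<in>V. \<forall>v\<in>V. f (u + v) = f u + f v) \<and> (\<forall>c. \<forall>u\<in>V. f (c *\<^sub>R u) = c *\<^sub>R f u)"

definition finite_dim_subspace :: "'a::real_vector set \<Rightarrow> bool" where
  "finite_dim_subspace V \<longleftrightarrow> subspace V \<and> (\<exists>B. finite B \<and> V = span B)"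

definition infinite_dim_subspace :: "'a::real_vector set \<Rightarrow> bool" where
  "infinite_dim_subspace V \<longleftrightarrow> subspace V \<and> \<not> (\<exists>B. finite B \<and> V = span B)"

definition discrete_spaces ::
  "(real^3) set \<Rightarrow> L2 set \<Rightarrow> (L2^3) set \<Rightarrow> (L2^3) set \<Rightarrow> L2 set \<Rightarrow> bool" where
  "discrete_spaces \<Omega> Vh0 Vh1 Vh2 Vh3 \<longleftrightarrow>
     finite_dim_subspace Vh0 \<and> finite_dim_subspace Vh1 \<and>
     finite_dim_subspace Vh2 \<and> finite_dim_subspace Vh3 \<and>
     Vh0 \<subseteq> L2_on \<Omega> \<and> Vh1 \<subseteq> L2_vec_on \<Omega> \<and> Vh2 \<subseteq> L2_vec_on \<Omega> \<and> Vh3 \<subseteq> L2_on \<Omega> \<and>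
     (\<forall>\<psi>\<in>Vh0. \<exists>C\<in>Vh1. has_grad \<Omega> \<psi> C) \<and>
     (\<forall>C\<in>Vh1. \<exists>F\<in>Vh2. has_curl \<Omega> C F) \<and>
     (\<forall>F\<in>Vh2. \<exists>g\<in>Vh3. has_div \<Omega> F g)"

definition discrete_adjoints ::
  "(real^3) set \<Rightarrow> L2 set \<Rightarrow> (L2^3) set \<Rightarrow> (L2^3) set \<Rightarrow>
   (L2^3 \<Rightarrow> L2^3) \<Rightarrow> (L2^3 \<Rightarrow> L2) \<Rightarrow> bool" where
  "discrete_adjoints \<Omega> Vh0 Vh1 Vh2 curl_w div_w \<longleftrightarrow>
     (\<forall>F\<in>Vh2. curl_w F \<in> Vh1) \<and> (\<forall>C\<in>Vh1. div_w C \<in> Vh0) \<and>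
     (\<forall>F\<in>Vh2. \<forall>C\<in>Vh1. \<forall>curlC\<in>Vh2. has_curl \<Omega> C curlC \<longrightarrow> curl_w F \<bullet> C = F \<bullet> curlC) \<and>
     (\<forall>C\<in>Vh1. \<forall>\<psi>\<in>Vh0. \<forall>grad\<psi>\<in>Vh1. has_grad \<Omega> \<psi> grad\<psi> \<longrightarrow> div_w C \<bullet> \<psi> = - (C \<bullet> grad\<psi>))"

definition continuous_spaces ::
  "distribution set \<Rightarrow> (distribution^3) set \<Rightarrow> (distribution^3) set \<Rightarrow> distribution set \<Rightarrow> bool" where
  "continuous_spaces V0 V1 V2 V3 \<longleftrightarrow>
     infinite_dim_subspace V0 \<and> infinite_dim_subspace V1 \<and>
     infinite_dim_subspace V2 \<and> infinite_dim_subspace V3 \<and>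
     dgrad ` V0 \<subseteq> V1 \<and> dcurl ` V1 \<subseteq> V2 \<and> ddiv ` V2 \<subseteq> V3 \<and>
     (\<forall>y. shift y ` V0 \<subseteq> V0 \<and> shift_vec y ` V1 \<subseteq> V1 \<and> shift_vec y ` V2 \<subseteq> V2 \<and> shift y ` V3 \<subseteq> V3)"

text \<open>
  The elements of the continuous spaces live on the whole space and those of the discrete spaces
  on \<open>\<Omega>\<close>.  The projection property therefore says that every discrete function has an
  extension in the continuous space (by zero, by periodicity, or itself when \<open>\<Omega>\<close> is the whole space)
  which is mapped back to that discrete function.
\<close>

definition projection_onto ::
  "(real^3) set \<Rightarrow> distribution set \<Rightarrow> L2 set \<Rightarrow> (distribution \<Rightarrow> L2) \<Rightarrow> bool" where
  "projection_onto \<Omega> V Vh P \<longleftrightarrow>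
     linear_map_on V Vh P \<and> (\<forall>g\<in>Vh. \<exists>G\<in>V. eq_on \<Omega> G (of_L2 g) \<and> P G = g)"

definition projection_vec_onto ::
  "(real^3) set \<Rightarrow> (distribution^3) set \<Rightarrow> (L2^3) set \<Rightarrow> (distribution^3 \<Rightarrow> L2^3) \<Rightarrow> bool" where
  "projection_vec_onto \<Omega> V Vh P \<longleftrightarrow>
     linear_map_on V Vh P \<and> (\<forall>g\<in>Vh. \<exists>G\<in>V. eq_vec_on \<Omega> G (of_L2_vec g) \<and> P G = g)"

definition commuting_projections ::
  "(real^3) set \<Rightarrow>
   distribution set \<Rightarrow> (distribution^3) set \<Rightarrow> (distribution^3) set \<Rightarrow> distribution set \<Rightarrow>
   L2 set \<Rightarrow> (L2^3) set \<Rightarrow> (L2^3) set \<Rightarrow> L2 set \<Rightarrow>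
   (distribution \<Rightarrow> L2) \<Rightarrow> (distribution^3 \<Rightarrow> L2^3) \<Rightarrow> (distribution^3 \<Rightarrow> L2^3) \<Rightarrow>
   (distribution \<Rightarrow> L2) \<Rightarrow> bool" where
  "commuting_projections \<Omega> V0 V1 V2 V3 Vh0 Vh1 Vh2 Vh3 \<Pi>0 \<Pi>1 \<Pi>2 \<Pi>3 \<longleftrightarrow>
     projection_onto \<Omega> V0 Vh0 \<Pi>0 \<and> projection_vec_onto \<Omega> V1 Vh1 \<Pi>1 \<and>
     projection_vec_onto \<Omega> V2 Vh2 \<Pi>2 \<and> projection_onto \<Omega> V3 Vh3 \<Pi>3 \<and>
     (\<forall>G\<in>V0. has_grad \<Omega> (\<Pi>0 G) (\<Pi>1 (dgrad G))) \<and>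
     (\<forall>G\<in>V1. has_curl \<Omega> (\<Pi>1 G) (\<Pi>2 (dcurl G))) \<and>
     (\<forall>G\<in>V2. has_div \<Omega> (\<Pi>2 G) (\<Pi>3 (ddiv G)))"

definition admissible_shape ::
  "distribution set \<Rightarrow> (distribution^3) set \<Rightarrow> (distribution^3) set \<Rightarrow> distribution set \<Rightarrow>
   distribution \<Rightarrow> bool" where
  "admissible_shape V0 V1 V2 V3 S \<longleftrightarrow>
     S \<in> V0 \<and> S \<in> V3 \<and> (\<forall>e. vscale e S \<in> V1) \<and> (\<forall>e. vscale e S \<in> V2)"

definition regular_in_position :: "(distribution \<Rightarrow> L2) \<Rightarrow> distribution \<Rightarrow> bool" where
  "regular_in_position \<Pi>3 S \<longleftrightarrow>
     (\<forall>y. ((\<lambda>y. \<Pi>3 (shift y S)) has_derivative (\<lambda>e. - \<Pi>3 (ddiv (vscale e (shift y S))))) (at y)) \<and>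
     (\<forall>e. continuous_on UNIV (\<lambda>y. \<Pi>3 (ddiv (vscale e (shift y S)))))"


section \<open>Discrete interior products\<close>

definition contract0 :: "real^3 \<Rightarrow> L2^3 \<Rightarrow> L2" where
  "contract0 e C = (\<Sum>i\<in>UNIV. (e $ i) *\<^sub>R (C $ i))"

text \<open>The pointwise cross product \<open>F \<times> e\<close>.\<close>

definition contract1 :: "real^3 \<Rightarrow> L2^3 \<Rightarrow> L2^3" where
  "contract1 e F = vector
     [(e $ 3) *\<^sub>R (F $ 2) - (e $ 2) *\<^sub>R (F $ 3),
      (e $ 1) *\<^sub>R (F $ 3) - (e $ 3) *\<^sub>R (F $ 1),
      (e $ 2) *\<^sub>R (F $ 1) - (e $ 1) *\<^sub>R (F $ 2)]"

definition contract2 :: "real^3 \<Rightarrow> L2 \<Rightarrow> L2^3" where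
  "contract2 e g = vscale e g"

definition componentwise :: "(L2 \<Rightarrow> L2) \<Rightarrow> L2^3 \<Rightarrow> L2^3" where
  "componentwise a F = (\<chi> i. a (F $ i))"

definition interior0 :: "(3 \<Rightarrow> L2 \<Rightarrow> L2) \<Rightarrow> 3 \<Rightarrow> L2^3 \<Rightarrow> L2" where
  "interior0 \<A> \<alpha> C = \<A> \<alpha> (contract0 (axis \<alpha> 1) C)"

definition interior1 :: "(3 \<Rightarrow> L2 \<Rightarrow> L2) \<Rightarrow> 3 \<Rightarrow> L2^3 \<Rightarrow> L2^3" where
  "interior1 \<A> \<alpha> F = componentwise (\<A> \<alpha>) (contract1 (axis \<alpha> 1) F)"

definition interior2 :: "(3 \<Rightarrow> L2 \<Rightarrow> L2) \<Rightarrow> 3 \<Rightarrow> L2 \<Rightarrow> L2^3" where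
  "interior2 \<A> \<alpha> g = componentwise (\<A> \<alpha>) (contract2 (axis \<alpha> 1) g)"

definition discrete_interior_products ::
  "(real^3) set \<Rightarrow> L2 set \<Rightarrow> (L2^3) set \<Rightarrow> (L2^3) set \<Rightarrow> L2 set \<Rightarrow> (3 \<Rightarrow> L2 \<Rightarrow> L2) \<Rightarrow> bool" where
  "discrete_interior_products \<Omega> Vh0 Vh1 Vh2 Vh3 \<A> \<longleftrightarrow> (\<forall>\<alpha>.
     linear_map_on (L2_on \<Omega>) (L2_on \<Omega>) (\<A> \<alpha>) \<and>
     interior0 \<A> \<alpha> ` Vh1 \<subseteq> Vh0 \<and> interior1 \<A> \<alpha> ` Vh2 \<subseteq> Vh1 \<and> interior2 \<A> \<alpha> ` Vh3 \<subseteq> Vh2 \<and>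
     (\<forall>C\<in>Vh1. \<forall>curlC\<in>Vh2. \<forall>gradIC\<in>Vh1.
        has_curl \<Omega> C curlC \<longrightarrow> has_grad \<Omega> (interior0 \<A> \<alpha> C) gradIC \<longrightarrow>
        C \<bullet> gradIC = - (C \<bullet> interior1 \<A> \<alpha> curlC)) \<and>
     (\<forall>F\<in>Vh2. \<forall>divF\<in>Vh3. \<forall>curlIF\<in>Vh2.
        has_div \<Omega> F divF \<longrightarrow> has_curl \<Omega> (interior1 \<A> \<alpha> F) curlIF \<longrightarrow>
        F \<bullet> curlIF = - (F \<bullet> interior2 \<A> \<alpha> divF)))"


section \<open>The scheme\<close>

definition electric_coupling ::
  "(3 \<Rightarrow> L2 \<Rightarrow> L2) \<Rightarrow> (distribution \<Rightarrow> L2) \<Rightarrow> distribution \<Rightarrow> L2^3 \<Rightarrow> real^3 \<Rightarrow> real^3" where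
  "electric_coupling \<A> \<Pi>3 S E x =
     (\<Sum>\<alpha>\<in>UNIV. (E \<bullet> interior2 \<A> \<alpha> (\<Pi>3 (shift x S))) *\<^sub>R axis \<alpha> 1)"

definition magnetic_coupling ::
  "(3 \<Rightarrow> L2 \<Rightarrow> L2) \<Rightarrow> (distribution^3 \<Rightarrow> L2^3) \<Rightarrow> distribution \<Rightarrow> L2^3 \<Rightarrow> real^3 \<Rightarrow> real^3 \<Rightarrow> real^3" where
  "magnetic_coupling \<A> \<Pi>2 S B x v =
     - (\<Sum>\<alpha>\<in>UNIV. (B \<bullet> interior1 \<A> \<alpha> (\<Pi>2 (vscale v (shift x S)))) *\<^sub>R axis \<alpha> 1)"

definition is_solution ::
  "(real^3) set \<Rightarrow> (L2^3) set \<Rightarrow> (L2^3) set \<Rightarrow> (L2^3 \<Rightarrow> L2^3) \<Rightarrow>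
   (distribution^3 \<Rightarrow> L2^3) \<Rightarrow> (distribution \<Rightarrow> L2) \<Rightarrow> (3 \<Rightarrow> L2 \<Rightarrow> L2) \<Rightarrow> distribution \<Rightarrow>
   nat \<Rightarrow> (nat \<Rightarrow> real) \<Rightarrow> (nat \<Rightarrow> real) \<Rightarrow> real set \<Rightarrow>
   (nat \<Rightarrow> real \<Rightarrow> real^3) \<Rightarrow> (nat \<Rightarrow> real \<Rightarrow> real^3) \<Rightarrow> (real \<Rightarrow> L2^3) \<Rightarrow> (real \<Rightarrow> L2^3) \<Rightarrow> bool" where
  "is_solution \<Omega> Vh1 Vh2 curl_w \<Pi>2 \<Pi>3 \<A> S N m q T X V E B \<longleftrightarrow> (\<forall>t\<in>T.
     E t \<in> Vh2 \<and> B t \<in> Vh1 \<and>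
     (\<exists>E' B'. \<exists>curlB\<in>Vh2.
        (E has_vector_derivative E') (at t within T) \<and>
        (B has_vector_derivative B') (at t within T) \<and>
        has_curl \<Omega> (B t) curlB \<and>
        - E' + curlB = (\<Sum>p=1..N. q p *\<^sub>R \<Pi>2 (vscale (V p t) (shift (X p t) S))) \<and>
        B' + curl_w (E t) = 0) \<and>
     (\<forall>p\<in>{1..N}.
        (X p has_vector_derivative V p t) (at t within T) \<and>
        (V p has_vector_derivative
           (q p / m p) *\<^sub>R (electric_coupling \<A> \<Pi>3 S (E t) (X p t)
                           + magnetic_coupling \<A> \<Pi>2 S (B t) (X p t) (V p t))) (at t within T)))"

definition electric_gauss_law ::
  "(real^3) set \<Rightarrow> (distribution \<Rightarrow> L2) \<Rightarrow> distribution \<Rightarrow> nat \<Rightarrow> (nat \<Rightarrow> real) \<Rightarrow>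
   (nat \<Rightarrow> real \<Rightarrow> real^3) \<Rightarrow> (real \<Rightarrow> L2^3) \<Rightarrow> real \<Rightarrow> bool" where
  "electric_gauss_law \<Omega> \<Pi>3 S N q X E t \<longleftrightarrow>
     has_div \<Omega> (E t) (\<Pi>3 (\<Sum>p=1..N. q p *\<^sub>R shift (X p t) S))"

definition magnetic_gauss_law :: "(L2^3 \<Rightarrow> L2) \<Rightarrow> (real \<Rightarrow> L2^3) \<Rightarrow> real \<Rightarrow> bool" where
  "magnetic_gauss_law div_w B t \<longleftrightarrow> div_w (B t) = 0"

definition discrete_momentum ::
  "(3 \<Rightarrow> L2 \<Rightarrow> L2) \<Rightarrow> nat \<Rightarrow> (nat \<Rightarrow> real) \<Rightarrow> (nat \<Rightarrow> real \<Rightarrow> real^3) \<Rightarrow>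
   (real \<Rightarrow> L2^3) \<Rightarrow> (real \<Rightarrow> L2^3) \<Rightarrow> real \<Rightarrow> real^3" where
  "discrete_momentum \<A> N m V E B t =
     (\<Sum>p=1..N. m p *\<^sub>R V p t) - (\<Sum>\<alpha>\<in>UNIV. (interior1 \<A> \<alpha> (E t) \<bullet> B t) *\<^sub>R axis \<alpha> 1)"

end

theory Submission
  imports Defs
begin

text \<open>
  Each conserved quantity has zero derivative on the interval \<open>T\<close>.  For the electric Gauss law, test
  against a test function on \<open>\<Omega>\<close>: \<open>div curl = 0\<close> in the sense of distributions and the commuting
  projections turn the divergence of Ampere's law into the continuity equation for the projected charge.
  For the magnetic one, pair \<open>B\<close> with a discrete gradient, which is orthogonal to the range of
  \<open>curl_w\<close>.  For the momentum, the two identities of the interior products together with the Gauss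
  laws give \<open>I\<^sup>1(curl B) \<bullet> B = 0\<close> and \<open>I\<^sup>1 E \<bullet> curl_w E = - E \<bullet> I\<^sup>2 (div E)\<close>, so the field contribution
  cancels the particle forces.  The approximation operators are not assumed continuous, but \<open>E\<close> stays
  in the finite-dimensional space \<open>Vh2\<close>, so \<open>I\<^sup>1 E\<close> can still be differentiated.
\<close>


section \<open>Symmetry of second derivatives\<close>

lemma has_real_derivative_along_axis:
  assumes "f differentiable (at (x + s *\<^sub>R axis i 1))"
  shows "((\<lambda>s. f (x + s *\<^sub>R axis i 1)) has_real_derivative partial i f (x + s *\<^sub>R axis i 1)) (at s)"
proof -
  let ?y = "x + s *\<^sub>R axis i 1"
  have f: "(f has_derivative frechet_derivative f (at ?y)) (at ?y)"
    using assms by (simp add: frechet_derivative_works)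
  have "((\<lambda>s. x + s *\<^sub>R axis i 1) has_derivative (\<lambda>h. h *\<^sub>R axis i 1)) (at s)"
    by (auto intro!: derivative_eq_intros)
  from has_derivative_compose[OF this f] show ?thesis
    unfolding has_field_derivative_def partial_def
    by (rule has_derivative_eq_rhs)
       (simp add: fun_eq_iff linear_scale[OF has_derivative_linear[OF f]])
qed

text \<open>Two applications of the mean value theorem to the second difference of \<open>f\<close>, which is symmetric
  in \<open>i\<close> and \<open>j\<close>.\<close>

lemma second_difference_eq_partial:
  assumes f: "\<And>x. f differentiable (at x)" and fi: "\<And>x. partial i f differentiable (at x)"
    and s: "0 < s"
  obtains y where "dist y x \<le> 2 * s"
    "f (x + s *\<^sub>R axis i 1 + s *\<^sub>R axis j 1) - f (x + s *\<^sub>R axis i 1) - f (x + s *\<^sub>R axis j 1) + f x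
      = s * s * partial j (partial i f) y"
proof -
  let ?a = "axis i 1 :: real^3" and ?b = "axis j 1 :: real^3"
  \<comment> \<open>The first mean value step, along axis \<open>i\<close>, acts on
    \<open>?d\<close>, the increment of \<open>f\<close> over a step \<open>s\<close> along axis
    \<open>j\<close>. Its derivative is an increment of \<open>partial i f\<close>, to which the
    second step applies along axis \<open>j\<close>.\<close>
  let ?d = "\<lambda>r. f (x + s *\<^sub>R ?b + r *\<^sub>R ?a) - f (x + r *\<^sub>R ?a)"
  have "\<exists>r. 0 < r \<and> r < s \<and>
      ?d s - ?d 0 = (s - 0) * (partial i f (x + s *\<^sub>R ?b + r *\<^sub>R ?a) - partial i f (x + r *\<^sub>R ?a))"
    by (intro MVT2 s DERIV_diff has_real_derivative_along_axis f)
  then obtain r where r: "0 < r" "r < s"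
    and d: "?d s - ?d 0 = s * (partial i f (x + s *\<^sub>R ?b + r *\<^sub>R ?a) - partial i f (x + r *\<^sub>R ?a))"
    by auto
  have "\<exists>u. 0 < u \<and> u < s \<and> partial i f (x + r *\<^sub>R ?a + s *\<^sub>R ?b) - partial i f (x + r *\<^sub>R ?a + 0 *\<^sub>R ?b)
      = (s - 0) * partial j (partial i f) (x + r *\<^sub>R ?a + u *\<^sub>R ?b)"
    by (intro MVT2 s has_real_derivative_along_axis fi)
  then obtain u where u: "0 < u" "u < s"
    and e: "partial i f (x + r *\<^sub>R ?a + s *\<^sub>R ?b) - partial i f (x + r *\<^sub>R ?a)
      = s * partial j (partial i f) (x + r *\<^sub>R ?a + u *\<^sub>R ?b)"
    by auto
  have "norm (r *\<^sub>R ?a + u *\<^sub>R ?b) \<le> 2 * s"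
    using norm_triangle_ineq[of "r *\<^sub>R ?a" "u *\<^sub>R ?b"] r u by simp
  then have "dist (x + r *\<^sub>R ?a + u *\<^sub>R ?b) x \<le> 2 * s"
    by (simp add: dist_norm add.assoc)
  moreover have "f (x + s *\<^sub>R ?a + s *\<^sub>R ?b) - f (x + s *\<^sub>R ?a) - f (x + s *\<^sub>R ?b) + f x
      = s * s * partial j (partial i f) (x + r *\<^sub>R ?a + u *\<^sub>R ?b)"
    using d e by (simp add: add.commute add.left_commute)
  ultimately show ?thesis by (rule that)
qed

text \<open>Both mixed derivatives equal the same second difference divided by \<open>s * s\<close>,
  each at a point within \<open>2 * s\<close> of \<open>x\<close>. They are continuous, so a small
  \<open>s\<close> makes them agree at \<open>x\<close> up to any \<open>e\<close>.\<close>

lemma partial_commute: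
  assumes "smooth f"
  shows "partial i (partial j f) = partial j (partial i f)"
proof
  fix x
  let ?g = "partial j (partial i f)" and ?h = "partial i (partial j f)"
  have *: "partials js f differentiable (at x)" for js x
    using assms by (simp add: smooth_def)
  have f: "f differentiable (at x)" "partial k f differentiable (at x)"
    "partial k (partial l f) differentiable (at x)" for x k l
    using *[of "[]" x] *[of "[k]" x] *[of "[k, l]" x] by (simp_all add: partials_def)
  have "\<bar>?h x - ?g x\<bar> < e" if "e > 0" for e
  proof -
    have "isCont ?g x" "isCont ?h x"
      by (rule differentiable_imp_continuous_within[OF f(3)])+
    then obtain d1 d2 where d: "d1 > 0" "d2 > 0"
      "\<And>y. dist y x < d1 \<Longrightarrow> dist (?g y) (?g x) < e / 2"
      "\<And>y. dist y x < d2 \<Longrightarrow> dist (?h y) (?h x) < e / 2"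
      unfolding continuous_at_eps_delta using half_gt_zero[OF \<open>e > 0\<close>] by metis
    \<comment> \<open>The divisor 3 puts \<open>2 * s\<close>, the distance allowed by
      \<open>second_difference_eq_partial\<close>, strictly inside both radii.\<close>
    define s where "s = min d1 d2 / 3"
    have s: "s > 0" "2 * s < d1" "2 * s < d2"
      using d(1,2) by (auto simp: s_def min_def)
    obtain y where y: "dist y x \<le> 2 * s"
      "f (x + s *\<^sub>R axis i 1 + s *\<^sub>R axis j 1) - f (x + s *\<^sub>R axis i 1) - f (x + s *\<^sub>R axis j 1) + f x = s * s * ?g y"
      using second_difference_eq_partial[OF f(1,2) s(1)] by blast
    obtain z where z: "dist z x \<le> 2 * s"
      "f (x + s *\<^sub>R axis j 1 + s *\<^sub>R axis i 1) - f (x + s *\<^sub>R axis j 1) - f (x + s *\<^sub>R axis i 1) + f x = s * s * ?h z"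
      using second_difference_eq_partial[OF f(1,2) s(1)] by blast
    have "s * s * ?g y = s * s * ?h z"
      unfolding y(2)[symmetric] z(2)[symmetric] by (simp add: algebra_simps)
    then have "?g y = ?h z"
      using s(1) by simp
    moreover have "dist (?g y) (?g x) < e / 2" "dist (?h z) (?h x) < e / 2"
      using d(3)[of y] d(4)[of z] y(1) z(1) s by auto
    ultimately show ?thesis
      by (simp add: dist_real_def abs_if split: if_splits)
  qed
  then have "\<bar>?h x - ?g x\<bar> \<le> 0"
    by (meson linorder_not_le order.irrefl)
  then show "?h x = ?g x" by simp
qed


section \<open>Distributional differential operators\<close>

lemma test_functions_mono: "\<phi> \<in> test_functions \<Omega> \<Longrightarrow> \<phi> \<in> test_functions UNIV"
  by (simp add: test_functions_def)

lemma eval_dpartial: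
  "\<phi> \<in> test_functions UNIV \<Longrightarrow>
    eval_distribution (dpartial i U) \<phi> = - eval_distribution U (partial i \<phi>)"
  by (simp add: dpartial.rep_eq)

lemma eval_ddiv:
  "\<phi> \<in> test_functions UNIV \<Longrightarrow>
    eval_distribution (ddiv G) \<phi> = - (\<Sum>i\<in>UNIV. eval_distribution (G $ i) (partial i \<phi>))"
  by (simp add: ddiv_def sum_3 plus_distribution.rep_eq eval_dpartial)

text \<open>The two signs from moving derivatives onto the test function cancel, which leaves
  \<open>partial_commute\<close>. Off the test functions both sides take the default value
  \<open>0\<close>.\<close>

lemma dpartial_commute: "dpartial i (dpartial j U) = dpartial j (dpartial i U)"
proof (rule eval_distribution_inject[THEN iffD1], rule ext)
  fix \<phi>
  show "eval_distribution (dpartial i (dpartial j U)) \<phi> = eval_distribution (dpartial j (dpartial i U)) \<phi>"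
    using test_functions_partial(1)[of \<phi> UNIV] partial_commute[of \<phi> i j]
    by (auto simp: dpartial.rep_eq test_functions_def)
qed

lemma dpartial_diff: "dpartial i (U - W) = dpartial i U - dpartial i W"
  by (rule eval_distribution_inject[THEN iffD1])
     (simp add: fun_eq_iff dpartial.rep_eq minus_distribution.rep_eq)

text \<open>The chosen instances of \<open>dpartial_commute\<close> sort the indices increasingly,
  after which the six second derivatives cancel in pairs.\<close>

lemma ddiv_dcurl: "ddiv (dcurl G) = 0"
  by (simp add: ddiv_def dcurl_def sum_3 dpartial_diff dpartial_commute[of 3] dpartial_commute[of 2 1])

lemma dcurl_dgrad: "dcurl (dgrad U) = 0"
  by (simp add: dcurl_def dgrad_def vec_eq_iff forall_3 dpartial_commute[of 3] dpartial_commute[of 2 1])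

lemma eq_on_sym: "eq_on \<Omega> U W \<Longrightarrow> eq_on \<Omega> W U"
  by (simp add: eq_on_def)

lemma eq_on_diff: "eq_on \<Omega> U U' \<Longrightarrow> eq_on \<Omega> W W' \<Longrightarrow> eq_on \<Omega> (U - W) (U' - W')"
  by (simp add: eq_on_def minus_distribution.rep_eq)

text \<open>Differentiating a test function does not enlarge its support, so equality on \<Omega>
  survives differentiation even when the distributions differ elsewhere.\<close>

lemma eq_on_dpartial: "eq_on \<Omega> U W \<Longrightarrow> eq_on \<Omega> (dpartial i U) (dpartial i W)"
  by (simp add: eq_on_def eval_dpartial test_functions_mono test_functions_partial(1))

lemma eq_on_ddiv: "eq_vec_on \<Omega> F G \<Longrightarrow> eq_on \<Omega> (ddiv F) (ddiv G)"
  by (simp add: eq_vec_on_def eq_on_def eval_ddiv test_functions_mono test_functions_partial(1))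

lemma eq_vec_on_dcurl: "eq_vec_on \<Omega> F G \<Longrightarrow> eq_vec_on \<Omega> (dcurl F) (dcurl G)"
  by (simp add: eq_vec_on_def forall_3 dcurl_def eq_on_diff eq_on_dpartial)

lemma shift_scaleR: "shift y (c *\<^sub>R U) = c *\<^sub>R shift y U"
  by (rule eval_distribution_inject[THEN iffD1])
     (simp add: fun_eq_iff shift.rep_eq scaleR_distribution.rep_eq)

text \<open>Turns translation invariance of a vector space into membership of the fields
  \<open>vscale e (shift y S)\<close> carried by a moving particle.\<close>

lemma shift_vec_vscale: "shift_vec y (vscale e U) = vscale e (shift y U)"
  by (simp add: shift_vec_def vscale_def shift_scaleR vec_eq_iff)


section \<open>Square-integrable functions as distributions\<close>

lemma test_function_square_integrable:
  assumes "\<phi> \<in> test_functions UNIV"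
  shows "square_integrable \<phi>"
proof -
  obtain M where M: "\<And>x. \<bar>\<phi> x\<bar> \<le> M * indicator (supp \<phi>) x"
    using test_functions_bounded_measurable(2)[OF assms] by blast
  have "compact (supp \<phi>)" using assms by (simp add: test_functions_def)
  then have "integrable lborel (\<lambda>x. M\<^sup>2 * indicator (supp \<phi>) x :: real)"
    using borel_compact emeasure_compact_finite by (intro integrable_mult_right integrable_real_indicator) auto
  then have "integrable lborel (\<lambda>x. (\<phi> x)\<^sup>2)"
  proof (rule Bochner_Integration.integrable_bound)
    show "(\<lambda>x. (\<phi> x)\<^sup>2) \<in> borel_measurable lborel"
      using test_functions_bounded_measurable(1)[OF assms] by auto
    have "(\<phi> x)\<^sup>2 \<le> M\<^sup>2 * indicator (supp \<phi>) x" for x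
      using power_mono[OF M abs_ge_zero, of x 2] by (cases "x \<in> supp \<phi>") auto
    then show "AE x in lborel. norm ((\<phi> x)\<^sup>2) \<le> norm (M\<^sup>2 * indicator (supp \<phi>) x :: real)"
      by (auto intro!: AE_I2 simp: indicator_def)
  qed
  then show ?thesis
    using test_functions_bounded_measurable(1)[OF assms] by (simp add: square_integrable_def)
qed

text \<open>A test function is itself square integrable, so evaluation at it is the inner product
  with a fixed element of \<open>L2\<close>. Boundedness lets time derivatives pass through the
  evaluation.\<close>

lemma bounded_linear_eval_of_L2: "bounded_linear (\<lambda>u. eval_distribution (of_L2 u) \<phi>)"
proof (cases "\<phi> \<in> test_functions UNIV")
  case True
  then have "L2_rel \<phi> \<phi>"
    by (simp add: L2_rel_def test_function_square_integrable)
  have "\<exists>w. \<forall>u. eval_distribution (of_L2 u) \<phi> = u \<bullet> w"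
    using True \<open>L2_rel \<phi> \<phi>\<close>
    \<comment> \<open>After transfer the witness must be a representative related to itself, which
      \<open>\<phi>\<close> is.\<close>
    by transfer (auto intro!: bexI[of _ \<phi>] simp: Respects_def)
  then obtain w where "\<And>u. eval_distribution (of_L2 u) \<phi> = u \<bullet> w" by blast
  then show ?thesis
    by (simp add: bounded_linear_inner_left)
next
  case False
  then have "eval_distribution U \<phi> = 0" for U
    using eval_distribution[of U] by (simp add: is_distribution_def)
  then show ?thesis by simp
qed

text \<open>Testing moves the derivatives onto \<open>\<phi>\<close>, so the functional is bounded
  although \<open>F\<close> is merely square integrable.\<close>

lemma bounded_linear_eval_ddiv_of_L2_vec:
  assumes "\<phi> \<in> test_functions UNIV"
  shows "bounded_linear (\<lambda>F. eval_distribution (ddiv (of_L2_vec F)) \<phi>)"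
proof -
  have "bounded_linear (\<lambda>F. eval_distribution (of_L2 (F $ i)) (partial i \<phi>))" for i
    by (rule bounded_linear_compose[OF bounded_linear_eval_of_L2 bounded_linear_vec_nth])
  then show ?thesis
    unfolding eval_ddiv[OF assms] of_L2_vec_def vec_lambda_beta
    by (intro bounded_linear_minus bounded_linear_sum)
qed

lemma of_L2_zero [simp]: "of_L2 0 = 0"
  by (rule eval_distribution_inject[THEN iffD1])
     (simp add: fun_eq_iff zero_distribution.rep_eq linear_0[OF bounded_linear.linear[OF bounded_linear_eval_of_L2]])

lemma has_div_iff:
  "has_div \<Omega> F g \<longleftrightarrow>
    (\<forall>\<phi>\<in>test_functions \<Omega>. eval_distribution (ddiv (of_L2_vec F)) \<phi> = eval_distribution (of_L2 g) \<phi>)"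
  by (simp add: has_div_def eq_on_def)

lemma has_div_diff:
  assumes "has_div \<Omega> F f" "has_div \<Omega> G g"
  shows "has_div \<Omega> (F - G) (f - g)"
  using assms unfolding has_div_iff
  by (simp add: linear_diff[OF bounded_linear.linear[OF bounded_linear_eval_of_L2]]
      linear_diff[OF bounded_linear.linear[OF bounded_linear_eval_ddiv_of_L2_vec[OF test_functions_mono]]])

lemma has_div_sum:
  assumes "\<And>i. i \<in> I \<Longrightarrow> has_div \<Omega> (F i) (g i)"
  shows "has_div \<Omega> (\<Sum>i\<in>I. c i *\<^sub>R F i) (\<Sum>i\<in>I. c i *\<^sub>R g i)"
  using assms unfolding has_div_iff
  by (simp add: linear_sum[OF bounded_linear.linear[OF bounded_linear_eval_of_L2]]
      linear_scale[OF bounded_linear.linear[OF bounded_linear_eval_of_L2]]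
      linear_sum[OF bounded_linear.linear[OF bounded_linear_eval_ddiv_of_L2_vec[OF test_functions_mono]]]
      linear_scale[OF bounded_linear.linear[OF bounded_linear_eval_ddiv_of_L2_vec[OF test_functions_mono]]])

text \<open>On \<Omega>, \<open>K\<close> coincides with a distributional curl, whose divergence
  vanishes; tests supported in \<Omega> see only that curl.\<close>

lemma has_div_has_curl:
  assumes "has_curl \<Omega> C K"
  shows "has_div \<Omega> K 0"
  using eq_on_sym[OF eq_on_ddiv[OF assms[unfolded has_curl_def]]]
  by (simp add: has_div_def ddiv_dcurl)

lemma has_curl_has_grad:
  assumes "has_grad \<Omega> u G"
  shows "has_curl \<Omega> G 0"
proof -
  have "of_L2_vec 0 = 0" by (simp add: of_L2_vec_def vec_eq_iff)
  then show ?thesis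
    using eq_vec_on_dcurl[OF assms[unfolded has_grad_def]] eq_on_sym
    by (simp add: has_curl_def dcurl_dgrad eq_vec_on_def)
qed


section \<open>Linear maps on subspaces\<close>

lemma linear_map_on_zero:
  assumes "linear_map_on W Z f" "subspace W"
  shows "f 0 = 0"
  using assms subspace_0[OF assms(2)] unfolding linear_map_on_def
  by (metis scaleR_zero_left)

lemma linear_map_on_sum_scaleR:
  assumes f: "linear_map_on W Z f" and W: "subspace W" and "\<And>i. i \<in> I \<Longrightarrow> w i \<in> W"
  shows "f (\<Sum>i\<in>I. c i *\<^sub>R w i) = (\<Sum>i\<in>I. c i *\<^sub>R f (w i))"
  using assms(3)
proof (induction I rule: infinite_finite_induct)
  case (insert i I)
  moreover have "c i *\<^sub>R w i \<in> W" "(\<Sum>i\<in>I. c i *\<^sub>R w i) \<in> W"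
    using insert.prems W by (auto intro!: subspace_sum subspace_scale)
  ultimately show ?case
    using f by (simp add: linear_map_on_def)
qed (simp_all add: linear_map_on_zero[OF f W])

text \<open>Expresses coordinates through inner products, which makes them continuous in
  \<open>u\<close>.\<close>

lemma orthogonal_expansion:
  fixes u :: "'a::real_inner"
  assumes C: "finite C" "pairwise orthogonal C" and "u \<in> span C"
  shows "u = (\<Sum>c\<in>C. ((u \<bullet> c) / (c \<bullet> c)) *\<^sub>R c)"
  using assms(3)
proof (induction rule: span_induct)
  case base
  define f where "f u = (\<Sum>c\<in>C. ((u \<bullet> c) / (c \<bullet> c)) *\<^sub>R c)" for u
  have "linear f"
    unfolding f_def
    by (rule linearI)
       (simp_all add: inner_add_left add_divide_distrib scaleR_add_left sum.distrib scaleR_sum_right)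
  then show ?case
    unfolding f_def[symmetric] subspace_def
    by (auto simp: linear_0 linear_add linear_scale)
next
  case (step a)
  have "(\<Sum>c\<in>C. ((a \<bullet> c) / (c \<bullet> c)) *\<^sub>R c) = (\<Sum>c\<in>C. if c = a then a else 0)"
  proof (rule sum.cong)
    fix c assume "c \<in> C"
    \<comment> \<open>If \<open>a = 0\<close>, its coefficient is \<open>0 / 0 = 0\<close> and both
      sides vanish.\<close>
    then show "((a \<bullet> c) / (c \<bullet> c)) *\<^sub>R c = (if c = a then a else 0)"
      using C(2) step by (auto simp: pairwise_def orthogonal_def)
  qed simp
  then show ?case
    using C(1) step by simp
qed

text \<open>The extension is \<open>f\<close> after the orthogonal projection onto \<open>W\<close>,
  written with the finitely many values of \<open>f\<close> on an orthogonal spanning set.\<close>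

lemma linear_map_on_bounded_extension:
  fixes f :: "'a::real_inner \<Rightarrow> 'b::real_normed_vector"
  assumes W: "finite_dim_subspace W" and f: "linear_map_on W Z f"
  obtains g where "bounded_linear g" "\<And>u. u \<in> W \<Longrightarrow> g u = f u"
proof -
  obtain B where "finite B" "W = span B"
    using W by (auto simp: finite_dim_subspace_def)
  with basis_orthogonal obtain C where C: "finite C" "W = span C" "pairwise orthogonal C"
    by metis
  let ?g = "\<lambda>u. \<Sum>c\<in>C. ((u \<bullet> c) / (c \<bullet> c)) *\<^sub>R f c"
  have "bounded_linear ?g"
    by (intro bounded_linear_sum bounded_linear_scaleR_const bounded_linear_compose[OF bounded_linear_divide]
        bounded_linear_inner_left)
  moreover have "?g u = f u" if "u \<in> W" for u
  proof -
    have "f u = f (\<Sum>c\<in>C. ((u \<bullet> c) / (c \<bullet> c)) *\<^sub>R c)"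
      using orthogonal_expansion[OF C(1,3)] that C(2) by metis
    also have "\<dots> = ?g u"
      using C(2) by (intro linear_map_on_sum_scaleR[OF f]) (auto intro: span_base)
    finally show ?thesis ..
  qed
  ultimately show ?thesis by (rule that)
qed

text \<open>The curve \<open>F\<close> stays in \<open>W\<close>, where \<open>f\<close> agrees with
  a bounded linear map, so that map can be differentiated instead.\<close>

lemma linear_map_on_has_vector_derivative:
  fixes f :: "'a::real_inner \<Rightarrow> 'b::real_normed_vector"
  assumes W: "finite_dim_subspace W" and f: "linear_map_on W Z f"
    and F: "(F has_vector_derivative F') (at t within T)"
    and "\<And>s. s \<in> T \<Longrightarrow> F s \<in> W" "F' \<in> W" "t \<in> T"
  shows "((\<lambda>s. f (F s)) has_vector_derivative f F') (at t within T)"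
proof -
  obtain g where g: "bounded_linear g" "\<And>u. u \<in> W \<Longrightarrow> g u = f u"
    using linear_map_on_bounded_extension[OF W f] by blast
  have "((\<lambda>s. g (F s)) has_vector_derivative f F') (at t within T)"
    using bounded_linear.has_vector_derivative[OF g(1) F] g(2)[OF assms(5)] by simp
  then show ?thesis
    by (rule has_vector_derivative_transform[OF assms(6), rotated]) (simp add: g(2) assms(4))
qed


section \<open>Discrete interior products on square-integrable fields\<close>

lemma subspace_L2_on: "subspace (L2_on \<Omega>)"
proof -
  have "vanishes_outside \<Omega> 0"
    by transfer simp
  moreover have "vanishes_outside \<Omega> (u + v)" if "vanishes_outside \<Omega> u" "vanishes_outside \<Omega> v" for u v
    using that by transfer (auto elim!: AE_mp)
  moreover have "vanishes_outside \<Omega> (c *\<^sub>R u)" if "vanishes_outside \<Omega> u" for c u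
    using that by transfer (auto elim!: AE_mp)
  ultimately show ?thesis
    by (simp add: subspace_def L2_on_def)
qed

lemma linear_contract1: "linear (contract1 e)"
  by (rule linearI) (simp_all add: contract1_def vec_eq_iff forall_3 algebra_simps)

lemma linear_contract2: "linear (contract2 e)"
  by (rule linearI) (simp_all add: contract2_def vscale_def vec_eq_iff algebra_simps)

lemma contract1_in_L2_vec_on: "F \<in> L2_vec_on \<Omega> \<Longrightarrow> contract1 e F \<in> L2_vec_on \<Omega>"
  by (simp add: L2_vec_on_def contract1_def forall_3 subspace_L2_on subspace_diff subspace_scale)

lemma contract2_in_L2_vec_on: "g \<in> L2_on \<Omega> \<Longrightarrow> contract2 e g \<in> L2_vec_on \<Omega>"
  by (simp add: L2_vec_on_def contract2_def vscale_def subspace_L2_on subspace_scale)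

lemma linear_map_on_componentwise:
  "linear_map_on (L2_on \<Omega>) (L2_on \<Omega>) a \<Longrightarrow>
    linear_map_on (L2_vec_on \<Omega>) (L2_vec_on \<Omega>) (componentwise a)"
  by (simp add: linear_map_on_def L2_vec_on_def componentwise_def vec_eq_iff)

lemma linear_map_on_comp_linear:
  assumes "linear_map_on W Z f" "linear h" "\<And>u. u \<in> W' \<Longrightarrow> h u \<in> W"
  shows "linear_map_on W' Z (\<lambda>u. f (h u))"
  using assms by (simp add: linear_map_on_def linear_add linear_scale)

lemma linear_map_on_subset: "linear_map_on W Z f \<Longrightarrow> W' \<subseteq> W \<Longrightarrow> linear_map_on W' Z f"
  by (simp add: linear_map_on_def subset_iff)

lemma linear_map_on_interior1:
  "linear_map_on (L2_on \<Omega>) (L2_on \<Omega>) (\<A> \<alpha>) \<Longrightarrow>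
    linear_map_on (L2_vec_on \<Omega>) (L2_vec_on \<Omega>) (interior1 \<A> \<alpha>)"
  unfolding interior1_def[abs_def]
  by (rule linear_map_on_comp_linear[OF linear_map_on_componentwise linear_contract1 contract1_in_L2_vec_on])

lemma linear_map_on_interior2:
  "linear_map_on (L2_on \<Omega>) (L2_on \<Omega>) (\<A> \<alpha>) \<Longrightarrow>
    linear_map_on (L2_on \<Omega>) (L2_vec_on \<Omega>) (interior2 \<A> \<alpha>)"
  unfolding interior2_def[abs_def]
  by (rule linear_map_on_comp_linear[OF linear_map_on_componentwise linear_contract2 contract2_in_L2_vec_on])

lemma sum_axis_nth: "(\<Sum>\<alpha>\<in>UNIV. (c \<alpha>) *\<^sub>R (axis \<alpha> 1 :: real^'n)) $ \<beta> = c \<beta>"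
  by (simp add: axis_def if_distrib cong: if_cong)


section \<open>Conservation laws of the scheme\<close>

lemma has_vector_derivative_zero_eq:
  assumes "convex T" "\<And>t. t \<in> T \<Longrightarrow> (f has_vector_derivative 0) (at t within T)" "s \<in> T" "t \<in> T"
  shows "f s = f t"
  using has_vector_derivative_zero_constant[OF assms(1,2)] assms(3,4) by metis

locale particle_scheme =
  fixes \<Omega> :: "(real^3) set"
    and V0 V3 :: "distribution set" and V1 V2 :: "(distribution^3) set"
    and Vh0 Vh3 :: "L2 set" and Vh1 Vh2 :: "(L2^3) set"
    and \<Pi>0 \<Pi>3 :: "distribution \<Rightarrow> L2" and \<Pi>1 \<Pi>2 :: "distribution^3 \<Rightarrow> L2^3"
    and curl_w :: "L2^3 \<Rightarrow> L2^3" and div_w :: "L2^3 \<Rightarrow> L2"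
    and S :: distribution and \<A> :: "3 \<Rightarrow> L2 \<Rightarrow> L2"
    and N :: nat and m q :: "nat \<Rightarrow> real"
    and T :: "real set"
    and X V :: "nat \<Rightarrow> real \<Rightarrow> real^3" and E B :: "real \<Rightarrow> L2^3"
  assumes spaces: "discrete_spaces \<Omega> Vh0 Vh1 Vh2 Vh3"
    and adjoints: "discrete_adjoints \<Omega> Vh0 Vh1 Vh2 curl_w div_w"
    and cont_spaces: "continuous_spaces V0 V1 V2 V3"
    and projections: "commuting_projections \<Omega> V0 V1 V2 V3 Vh0 Vh1 Vh2 Vh3 \<Pi>0 \<Pi>1 \<Pi>2 \<Pi>3"
    and shape: "admissible_shape V0 V1 V2 V3 S"
    and regular: "regular_in_position \<Pi>3 S"
    and interior: "discrete_interior_products \<Omega> Vh0 Vh1 Vh2 Vh3 \<A>"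
    and mass: "\<And>p. p \<in> {1..N} \<Longrightarrow> m p \<noteq> 0"
    and interval: "is_interval T"
    and solution: "is_solution \<Omega> Vh1 Vh2 curl_w \<Pi>2 \<Pi>3 \<A> S N m q T X V E B"
begin

section \<open>Projected charge and current, and the continuity equation\<close>

definition charge :: "real \<Rightarrow> L2" where
  "charge t = (\<Sum>p=1..N. q p *\<^sub>R \<Pi>3 (shift (X p t) S))"

definition current :: "real \<Rightarrow> L2^3" where
  "current t = (\<Sum>p=1..N. q p *\<^sub>R \<Pi>2 (vscale (V p t) (shift (X p t) S)))"

text \<open>The commuting diagram makes this a weak divergence of \<open>current\<close>. Having
  \<open>\<Pi>3\<close> outermost matches the derivative in
  \<open>regular_in_position\<close>.\<close>

definition div_current :: "real \<Rightarrow> L2" where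
  "div_current t = (\<Sum>p=1..N. q p *\<^sub>R \<Pi>3 (ddiv (vscale (V p t) (shift (X p t) S))))"

lemma convex_T: "convex T"
  using interval by (simp add: is_interval_convex)

lemma subspaces: "subspace Vh1" "subspace Vh2" "subspace Vh3"
  using spaces by (auto simp: discrete_spaces_def finite_dim_subspace_def)

lemma shift_shape_in: "shift y S \<in> V3" "vscale e (shift y S) \<in> V2"
proof -
  show "shift y S \<in> V3"
    using cont_spaces shape by (simp add: continuous_spaces_def admissible_shape_def image_subset_iff)
  have "shift_vec y (vscale e S) \<in> V2"
    using cont_spaces shape by (simp add: continuous_spaces_def admissible_shape_def image_subset_iff)
  then show "vscale e (shift y S) \<in> V2"
    by (simp add: shift_vec_vscale)
qed

lemma projected_shape_in:
  "\<Pi>3 (shift y S) \<in> Vh3" "\<Pi>2 (vscale e (shift y S)) \<in> Vh2"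
  using projections shift_shape_in
  by (auto simp: commuting_projections_def projection_onto_def projection_vec_onto_def linear_map_on_def)

lemma charge_in: "charge t \<in> Vh3" and current_in: "current t \<in> Vh2"
  unfolding charge_def current_def
  by (intro subspace_sum subspace_scale subspaces projected_shape_in)+

text \<open>The Gauss law projects the total density, whereas time derivatives are known particle by
  particle; linearity of \<open>\<Pi>3\<close> on \<open>V3\<close> reconciles the two.\<close>

lemma projected_charge: "\<Pi>3 (\<Sum>p=1..N. q p *\<^sub>R shift (X p t) S) = charge t"
  unfolding charge_def
proof (rule linear_map_on_sum_scaleR)
  show "linear_map_on V3 Vh3 \<Pi>3" "subspace V3"
    using projections cont_spaces
    by (simp_all add: commuting_projections_def projection_onto_def continuous_spaces_def
        infinite_dim_subspace_def)
qed (rule shift_shape_in)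

lemma has_div_current: "has_div \<Omega> (current t) (div_current t)"
  unfolding current_def div_current_def
  by (intro has_div_sum)
     (use projections shift_shape_in in \<open>auto simp: commuting_projections_def\<close>)

lemma particle_derivatives:
  assumes "t \<in> T" "p \<in> {1..N}"
  shows "(X p has_vector_derivative V p t) (at t within T)"
    and "(V p has_vector_derivative
      (q p / m p) *\<^sub>R (electric_coupling \<A> \<Pi>3 S (E t) (X p t)
        + magnetic_coupling \<A> \<Pi>2 S (B t) (X p t) (V p t))) (at t within T)"
  using solution assms by (auto simp: is_solution_def)

lemma field_in: "t \<in> T \<Longrightarrow> E t \<in> Vh2" "t \<in> T \<Longrightarrow> B t \<in> Vh1"
  using solution by (auto simp: is_solution_def)

text \<open>\<open>is_solution\<close> asserts only that some derivatives satisfy the field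
  equations; here the equations are solved for them.\<close>

lemma field_derivatives:
  assumes "t \<in> T"
  obtains curlB where "curlB \<in> Vh2" "has_curl \<Omega> (B t) curlB"
    "(E has_vector_derivative curlB - current t) (at t within T)"
    "(B has_vector_derivative - curl_w (E t)) (at t within T)"
proof -
  obtain E' B' curlB where *: "curlB \<in> Vh2" "has_curl \<Omega> (B t) curlB"
    "(E has_vector_derivative E') (at t within T)" "(B has_vector_derivative B') (at t within T)"
    "- E' + curlB = current t" "B' + curl_w (E t) = 0"
    using solution assms unfolding is_solution_def current_def by blast
  have "E' = curlB - current t" "B' = - curl_w (E t)"
    using *(5,6) by (auto simp: algebra_simps eq_neg_iff_add_eq_0)
  with * that show ?thesis by blast
qed

text \<open>The continuity equation for the projected charge and current.\<close>

lemma charge_has_vector_derivative: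
  assumes "t \<in> T"
  shows "(charge has_vector_derivative - div_current t) (at t within T)"
proof -
  have d: "((\<lambda>t. \<Pi>3 (shift (X p t) S)) has_vector_derivative
      - \<Pi>3 (ddiv (vscale (V p t) (shift (X p t) S)))) (at t within T)" if p: "p \<in> {1..N}" for p
  proof -
    have *: "((\<lambda>y. \<Pi>3 (shift y S)) has_derivative (\<lambda>e. - \<Pi>3 (ddiv (vscale e (shift (X p t) S))))) (at (X p t))"
      using regular by (simp add: regular_in_position_def)
    \<comment> \<open>The chain rule gives the derivative in the direction
      \<open>h *\<^sub>R V p t\<close>; its linearity in the direction takes \<open>h\<close>
      out.\<close>
    from has_derivative_compose[OF particle_derivatives(1)[OF assms p, unfolded has_vector_derivative_def] *]
    show ?thesis
      unfolding has_vector_derivative_def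
      by (rule has_derivative_eq_rhs) (simp add: fun_eq_iff linear_scale[OF has_derivative_linear[OF *]])
  qed
  have "(charge has_vector_derivative (\<Sum>p=1..N. q p *\<^sub>R - \<Pi>3 (ddiv (vscale (V p t) (shift (X p t) S)))))
      (at t within T)"
    unfolding charge_def[abs_def]
    by (intro has_vector_derivative_sum bounded_linear.has_vector_derivative[OF bounded_linear_scaleR_right] d)
  then show ?thesis
    by (simp add: div_current_def sum_negf)
qed

section \<open>Electric Gauss law\<close>

lemma electric_gauss_law_iff: "electric_gauss_law \<Omega> \<Pi>3 S N q X E t \<longleftrightarrow> has_div \<Omega> (E t) (charge t)"
  by (simp only: electric_gauss_law_def projected_charge)

text \<open>For each test function the defect \<open>?d (E t) - ?c (charge t)\<close> is a real
  function of time. It is constant because both terms change at the rate of the tested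
  \<open>- div_current t\<close>.\<close>

lemma electric_gauss_law_preserved:
  assumes "electric_gauss_law \<Omega> \<Pi>3 S N q X E s" "s \<in> T" "t \<in> T"
  shows "electric_gauss_law \<Omega> \<Pi>3 S N q X E t"
  unfolding electric_gauss_law_iff has_div_iff
proof
  fix \<phi> assume \<phi>: "\<phi> \<in> test_functions \<Omega>"
  let ?d = "\<lambda>F. eval_distribution (ddiv (of_L2_vec F)) \<phi>" and ?c = "\<lambda>u. eval_distribution (of_L2 u) \<phi>"
  note lin = bounded_linear_eval_ddiv_of_L2_vec[OF test_functions_mono[OF \<phi>]]
    bounded_linear_eval_of_L2[of \<phi>]
  have "((\<lambda>t. ?d (E t) - ?c (charge t)) has_vector_derivative 0) (at t within T)" if t: "t \<in> T" for t
  proof -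
    obtain curlB where curlB: "has_curl \<Omega> (B t) curlB"
      "(E has_vector_derivative curlB - current t) (at t within T)"
      using field_derivatives[OF t] by blast
    have "?d (curlB - current t) = ?c (- div_current t)"
      using has_div_diff[OF has_div_has_curl[OF curlB(1)] has_div_current] \<phi> by (simp add: has_div_iff)
    with has_vector_derivative_diff[OF
        bounded_linear.has_vector_derivative[OF lin(1) curlB(2)]
        bounded_linear.has_vector_derivative[OF lin(2) charge_has_vector_derivative[OF t]]]
    show ?thesis by simp
  qed
  then have "?d (E t) - ?c (charge t) = ?d (E s) - ?c (charge s)"
    by (rule has_vector_derivative_zero_eq[OF convex_T _ assms(3,2)])
  then show "?d (E t) = ?c (charge t)"
    using assms(1) \<phi> by (simp add: electric_gauss_law_iff has_div_iff)
qed

section \<open>Magnetic Gauss law\<close>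

text \<open>Adjointness moves the curl onto the gradient \<open>G\<close>, and the zero field is a
  curl of \<open>G\<close> in \<open>Vh2\<close>.\<close>

lemma curl_w_inner_grad:
  assumes "F \<in> Vh2" "G \<in> Vh1" "has_grad \<Omega> \<psi> G"
  shows "curl_w F \<bullet> G = 0"
  using adjoints assms subspace_0[OF subspaces(2)] has_curl_has_grad[OF assms(3)]
  unfolding discrete_adjoints_def by (metis inner_zero_right)

lemma magnetic_gauss_law_preserved:
  assumes "magnetic_gauss_law div_w B s" "s \<in> T" "t \<in> T"
  shows "magnetic_gauss_law div_w B t"
proof -
  have \<psi>: "div_w (B t) \<in> Vh0"
    using adjoints field_in(2)[OF assms(3)] by (simp add: discrete_adjoints_def)
  \<comment> \<open>The test function is the residual at the final time \<open>t\<close>, kept fixed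
    while \<open>r\<close> varies; its squared norm then turns out to be zero.\<close>
  then obtain G where G: "G \<in> Vh1" "has_grad \<Omega> (div_w (B t)) G"
    using spaces by (auto simp: discrete_spaces_def)
  have div_w: "div_w (B r) \<bullet> div_w (B t) = - (B r \<bullet> G)" if "r \<in> T" for r
    using adjoints field_in(2)[OF that] \<psi> G by (simp add: discrete_adjoints_def)
  have "((\<lambda>r. B r \<bullet> G) has_vector_derivative 0) (at r within T)" if r: "r \<in> T" for r
  proof -
    have "(B has_vector_derivative - curl_w (E r)) (at r within T)"
      using field_derivatives[OF r] by blast
    from bounded_linear.has_vector_derivative[OF bounded_linear_inner_left this, of G]
    show ?thesis
      using curl_w_inner_grad[OF field_in(1)[OF r] G] by simp
  qed
  then have "B t \<bullet> G = B s \<bullet> G"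
    by (rule has_vector_derivative_zero_eq[OF convex_T _ assms(3,2)])
  then have "div_w (B t) \<bullet> div_w (B t) = 0"
    using div_w[OF assms(2)] div_w[OF assms(3)] assms(1) by (simp add: magnetic_gauss_law_def)
  then show ?thesis
    by (simp add: magnetic_gauss_law_def)
qed

section \<open>Momentum balance\<close>

lemma linear_map_on_interior:
  shows "linear_map_on Vh2 (L2_vec_on \<Omega>) (interior1 \<A> \<alpha>)"
    and "linear_map_on Vh3 (L2_vec_on \<Omega>) (interior2 \<A> \<alpha>)"
  using interior spaces
  by (auto simp: discrete_interior_products_def discrete_spaces_def
      intro: linear_map_on_subset[OF linear_map_on_interior1] linear_map_on_subset[OF linear_map_on_interior2])

lemma interior1_in: "F \<in> Vh2 \<Longrightarrow> interior1 \<A> \<alpha> F \<in> Vh1"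
  using interior by (simp add: discrete_interior_products_def image_subset_iff)

text \<open>The first interior product identity trades \<open>K\<close> for the gradient of
  \<open>interior0 \<A> \<alpha> C\<close>, which is orthogonal to a field of zero weak
  divergence.\<close>

lemma interior1_curl_inner:
  assumes "C \<in> Vh1" "K \<in> Vh2" "has_curl \<Omega> C K" "div_w C = 0"
  shows "interior1 \<A> \<alpha> K \<bullet> C = 0"
proof -
  have \<psi>: "interior0 \<A> \<alpha> C \<in> Vh0"
    using interior assms(1) by (simp add: discrete_interior_products_def image_subset_iff)
  then obtain G where G: "G \<in> Vh1" "has_grad \<Omega> (interior0 \<A> \<alpha> C) G"
    using spaces by (auto simp: discrete_spaces_def)
  have "interior1 \<A> \<alpha> K \<bullet> C = - (C \<bullet> G)"
    using interior assms(1-3) G by (simp add: discrete_interior_products_def inner_commute)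
  also have "\<dots> = div_w C \<bullet> interior0 \<A> \<alpha> C"
    using adjoints assms(1) \<psi> G by (simp add: discrete_adjoints_def)
  finally show ?thesis
    using assms(4) by simp
qed

text \<open>Adjointness moves the curl onto \<open>interior1 \<A> \<alpha> F\<close>, where the
  second interior product identity applies. With \<open>g\<close> the charge this becomes the total
  electric force, up to sign.\<close>

lemma interior1_inner_curl_w:
  assumes "F \<in> Vh2" "g \<in> Vh3" "has_div \<Omega> F g"
  shows "interior1 \<A> \<alpha> F \<bullet> curl_w F = - (F \<bullet> interior2 \<A> \<alpha> g)"
proof -
  obtain K where K: "K \<in> Vh2" "has_curl \<Omega> (interior1 \<A> \<alpha> F) K"
    using spaces interior1_in[OF assms(1)] unfolding discrete_spaces_def by meson
  have "curl_w F \<bullet> interior1 \<A> \<alpha> F = F \<bullet> K"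
    using adjoints assms(1) interior1_in[OF assms(1)] K by (simp add: discrete_adjoints_def)
  also have "\<dots> = - (F \<bullet> interior2 \<A> \<alpha> g)"
    using interior assms K by (simp add: discrete_interior_products_def)
  finally show ?thesis
    by (simp add: inner_commute)
qed

lemma momentum_has_vector_derivative_zero:
  assumes t: "t \<in> T" and "electric_gauss_law \<Omega> \<Pi>3 S N q X E t" "magnetic_gauss_law div_w B t"
  shows "((\<lambda>t. (\<Sum>p=1..N. m p * V p t $ \<alpha>) - interior1 \<A> \<alpha> (E t) \<bullet> B t) has_vector_derivative 0)
    (at t within T)"
proof -
  obtain curlB where curlB: "curlB \<in> Vh2" "has_curl \<Omega> (B t) curlB"
    and E': "(E has_vector_derivative curlB - current t) (at t within T)"
    and B': "(B has_vector_derivative - curl_w (E t)) (at t within T)"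
    using field_derivatives[OF t] by blast
  let ?I1 = "interior1 \<A> \<alpha>" and ?I2 = "interior2 \<A> \<alpha>"
  let ?J = "\<lambda>p. \<Pi>2 (vscale (V p t) (shift (X p t) S))" and ?\<rho> = "\<lambda>p. \<Pi>3 (shift (X p t) S)"
  \<comment> \<open>Both \<open>curlB\<close> and \<open>current t\<close> lie in
    \<open>Vh2\<close>, so the rule for linear maps on a finite-dimensional subspace
    applies.\<close>
  have IE': "((\<lambda>t. ?I1 (E t)) has_vector_derivative ?I1 (curlB - current t)) (at t within T)"
    using spaces curlB(1) current_in field_in(1)
    by (intro linear_map_on_has_vector_derivative[OF _ linear_map_on_interior(1) E'] t)
       (auto simp: discrete_spaces_def intro!: subspace_diff subspaces)
  have "?I1 (curlB - current t) = ?I1 curlB - ?I1 (current t)"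
  proof -
    \<comment> \<open>\<open>linear_map_on\<close> speaks only of sums and multiples, hence the
      factor \<open>- 1\<close>.\<close>
    have "?I1 (curlB + (- 1) *\<^sub>R current t) = ?I1 curlB + (- 1) *\<^sub>R ?I1 (current t)"
      using linear_map_on_interior(1)[of \<alpha>] curlB(1) current_in[of t] subspaces(2)
        subspace_scale[OF subspaces(2) current_in, of "- 1" t]
      unfolding linear_map_on_def by metis
    then show ?thesis by simp
  qed
  also have "?I1 (current t) = (\<Sum>p=1..N. q p *\<^sub>R ?I1 (?J p))"
    unfolding current_def
    by (intro linear_map_on_sum_scaleR[OF linear_map_on_interior(1) subspaces(2)] projected_shape_in)
  \<comment> \<open>The term with \<open>curlB\<close> vanishes by the magnetic Gauss law; only the
    current is left.\<close>
  finally have magnetic: "?I1 (curlB - current t) \<bullet> B t = - (\<Sum>p=1..N. q p * (B t \<bullet> ?I1 (?J p)))"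
    using interior1_curl_inner[OF field_in(2)[OF t] curlB] assms(3)
    by (simp add: magnetic_gauss_law_def inner_diff_left inner_sum_left inner_commute[of _ "B t"]
        inner_diff_right inner_sum_right)
  have "?I2 (charge t) = (\<Sum>p=1..N. q p *\<^sub>R ?I2 (?\<rho> p))"
    unfolding charge_def
    by (intro linear_map_on_sum_scaleR[OF linear_map_on_interior(2) subspaces(3)] projected_shape_in)
  \<comment> \<open>The electric Gauss law supplies \<open>charge t\<close> as the divergence of
    \<open>E t\<close>.\<close>
  then have electric: "?I1 (E t) \<bullet> curl_w (E t) = - (\<Sum>p=1..N. q p * (E t \<bullet> ?I2 (?\<rho> p)))"
    using interior1_inner_curl_w[OF field_in(1)[OF t] charge_in] assms(2)
    by (simp add: electric_gauss_law_iff inner_sum_right)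
  \<comment> \<open>The mass cancels the denominator of \<open>q p / m p\<close>. Summed over the
    particles, these rates equal the derivative of the field term subtracted from them.\<close>
  have d: "((\<lambda>t. m p * V p t $ \<alpha>) has_vector_derivative
      q p * (E t \<bullet> ?I2 (?\<rho> p)) - q p * (B t \<bullet> ?I1 (?J p))) (at t within T)" if p: "p \<in> {1..N}" for p
  proof -
    have "bounded_linear (\<lambda>v. m p * v $ \<alpha> :: real)"
      by (intro bounded_linear_compose[OF bounded_linear_mult_right bounded_linear_vec_nth])
    from bounded_linear.has_vector_derivative[OF this particle_derivatives(2)[OF t p]] mass[OF p]
    show ?thesis
      by (simp add: electric_coupling_def magnetic_coupling_def sum_axis_nth right_diff_distrib
          del: sum_component)
  qed
  have "((\<lambda>t. \<Sum>p=1..N. m p * V p t $ \<alpha>) has_vector_derivative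
      (\<Sum>p=1..N. q p * (E t \<bullet> ?I2 (?\<rho> p)) - q p * (B t \<bullet> ?I1 (?J p)))) (at t within T)"
    by (rule has_vector_derivative_sum) (rule d)
  moreover have "((\<lambda>t. ?I1 (E t) \<bullet> B t) has_vector_derivative
      ?I1 (E t) \<bullet> (- curl_w (E t)) + ?I1 (curlB - current t) \<bullet> B t) (at t within T)"
    by (rule bounded_bilinear.has_vector_derivative[OF bounded_bilinear_inner IE' B'])
  ultimately show ?thesis
    using magnetic electric
    by (auto dest: has_vector_derivative_diff simp: sum_subtractf)
qed

lemma discrete_momentum_constant:
  assumes "\<And>t. t \<in> T \<Longrightarrow> electric_gauss_law \<Omega> \<Pi>3 S N q X E t \<and> magnetic_gauss_law div_w B t"
  shows "discrete_momentum \<A> N m V E B constant_on T"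
proof -
  have "discrete_momentum \<A> N m V E B s = discrete_momentum \<A> N m V E B t" if "s \<in> T" "t \<in> T" for s t
  proof -
    have "discrete_momentum \<A> N m V E B r $ \<alpha> =
        (\<Sum>p=1..N. m p * V p r $ \<alpha>) - interior1 \<A> \<alpha> (E r) \<bullet> B r" for r \<alpha>
      unfolding discrete_momentum_def vector_minus_component sum_axis_nth by simp
    moreover have "(\<Sum>p=1..N. m p * V p s $ \<alpha>) - interior1 \<A> \<alpha> (E s) \<bullet> B s
        = (\<Sum>p=1..N. m p * V p t $ \<alpha>) - interior1 \<A> \<alpha> (E t) \<bullet> B t" for \<alpha>
      using momentum_has_vector_derivative_zero assms
      by (intro has_vector_derivative_zero_eq[OF convex_T _ that]) blast
    ultimately show ?thesis
      by (simp only: vec_eq_iff) simp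
  qed
  then show ?thesis
    unfolding constant_on_def by blast
qed

end

theorem theorem3:
  fixes \<Omega> :: "(real^3) set"
    and V0 V3 :: "distribution set" and V1 V2 :: "(distribution^3) set"
    and Vh0 Vh3 :: "L2 set" and Vh1 Vh2 :: "(L2^3) set"
    and \<Pi>0 \<Pi>3 :: "distribution \<Rightarrow> L2" and \<Pi>1 \<Pi>2 :: "distribution^3 \<Rightarrow> L2^3"
    and curl_w :: "L2^3 \<Rightarrow> L2^3" and div_w :: "L2^3 \<Rightarrow> L2"
    and S :: distribution and \<A> :: "3 \<Rightarrow> L2 \<Rightarrow> L2"
    and N :: nat and m q :: "nat \<Rightarrow> real"
    and T :: "real set" and t0 :: real
    and X V :: "nat \<Rightarrow> real \<Rightarrow> real^3" and E B :: "real \<Rightarrow> L2^3"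
  assumes "open \<Omega>"
    and "discrete_spaces \<Omega> Vh0 Vh1 Vh2 Vh3"
    and "discrete_adjoints \<Omega> Vh0 Vh1 Vh2 curl_w div_w"
    and "continuous_spaces V0 V1 V2 V3"
    and "commuting_projections \<Omega> V0 V1 V2 V3 Vh0 Vh1 Vh2 Vh3 \<Pi>0 \<Pi>1 \<Pi>2 \<Pi>3"
    and "admissible_shape V0 V1 V2 V3 S"
    and "regular_in_position \<Pi>3 S"
    and "discrete_interior_products \<Omega> Vh0 Vh1 Vh2 Vh3 \<A>"
    and "\<And>p. p \<in> {1..N} \<Longrightarrow> m p \<noteq> 0"
    and "is_interval T" and "t0 \<in> T"
    and "is_solution \<Omega> Vh1 Vh2 curl_w \<Pi>2 \<Pi>3 \<A> S N m q T X V E B"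
  shows "(electric_gauss_law \<Omega> \<Pi>3 S N q X E t0 \<longrightarrow>
            (\<forall>t\<in>T. electric_gauss_law \<Omega> \<Pi>3 S N q X E t)) \<and>
         (magnetic_gauss_law div_w B t0 \<longrightarrow> (\<forall>t\<in>T. magnetic_gauss_law div_w B t)) \<and>
         ((\<forall>t\<in>T. electric_gauss_law \<Omega> \<Pi>3 S N q X E t \<and> magnetic_gauss_law div_w B t) \<longrightarrow>
            discrete_momentum \<A> N m V E B constant_on T)"
proof -
  interpret particle_scheme \<Omega> V0 V3 V1 V2 Vh0 Vh3 Vh1 Vh2 \<Pi>0 \<Pi>3 \<Pi>1 \<Pi>2 curl_w div_w S \<A> N m q T X V E B
    by unfold_locales (fact assms)+
  show ?thesis
    using electric_gauss_law_preserved magnetic_gauss_law_preserved discrete_momentum_constant \<open>t0 \<in> T\<close>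
    by blast
qed

end
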